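(* In the Nakagami model with parameters $L_c>0$, $L_s>0$, the optimal distortion exponent satisfies $\limsup_{\rho\to\infty}-\frac{\log ED^*(\rho)}{\log\rho}\le\min\{\Delta_{pe}(L_s,L_c),\Delta_{\mathrm{inf}}(L_s,L_c)\}$, where $\Delta_{pe}(L_s,L_c)=1+(1-1/L_s)^+$, $\Delta_{\mathrm{inf}}(L_s,L_c)=\min\{L_c,1\}+\min\{L_s,1\}$, and $$\min\{\Delta_{pe},\Delta_{\mathrm{inf}}\}=\begin{cases}\min\{1,L_s+L_c\}&\text{if }L_s\le1,\\ 2-\frac1{L_s}&\text{if }1<L_s\le\frac{1}{(1-L_c)^+},\\ 1+L_c&\text{if }L_s>\frac{1}{(1-L_c)^+},\end{cases}$$ with the convention $\frac{1}{0}=+\infty$.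
   Context: System model: $S_1,\dots,S_n$ are i.i.d. $\mathcal N(0,1)$. $H_c,\Gamma_c$ are real random variables (channel and side-information fading states), mutually independent and independent of the source and the noises, constant over the whole block. Write $H=H_c^2$, $\Gamma=\Gamma_c^2$. An encoder is any map $f^n:\mathbb R^n\to\mathbb R^n$, $X^n=f^n(S^n)$, with $\frac1n\sum_{i=1}^n\mathrm E[X_i^2]\le1$, not observing $H_c,\Gamma_c$. The decoder observes $Y^n=H_cX^n+N^n$, $T^n=\Gamma_cS^n+Z^n$, and $H_c,\Gamma_c$, with $N^n,Z^n$ i.i.d. $\mathcal N(0,1)$ independent of everything else; $\hat S^n=g^n(Y^n,T^n,H_c,\Gamma_c)$. $D=\frac1n\sum_i(S_i-\hat S_i)^2$, $ED^*=\lim_{n\to\infty}\inf_{f^n,g^n}\mathrm E[D]$. Nakagami model: for SNR $\rho>0$, $H=\rho H_0$ and $\Gamma=\rho\Gamma_0$, where $H_0,\Gamma_0$ are independent, $H_0$ is Gamma distributed with shape $L_c$ and scale $1/L_c$, and $\Gamma_0$ is Gamma distributed with shape $L_s$ and scale $1/L_s$ (Gamma$(L,\theta)$ density $\frac{1}{\theta^L\Gamma(L)}x^{L-1}e^{-x/\theta}$, $x\ge0$). $ED^*(\rho)$ denotes $ED^*$ for this model at SNR $\rho$. $(x)^+=\max\{0,x\}$. *)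

theory Defs
  imports "HOL-Probability.Probability"
begin

definition std_gauss :: "real measure" where
  "std_gauss = density lborel (\<lambda>x. ennreal (std_normal_density x))"

definition gamma_density :: "real \<Rightarrow> real \<Rightarrow> real \<Rightarrow> real" where
  "gamma_density L \<theta> x =
     (if 0 \<le> x then x powr (L - 1) * exp (- x / \<theta>) / (\<theta> powr L * Gamma L) else 0)"

definition gamma_measure :: "real \<Rightarrow> real \<Rightarrow> real measure" where
  "gamma_measure L \<theta> = density lborel (\<lambda>x. ennreal (gamma_density L \<theta> x))"

text \<open>Length-n real vectors are extensional functions on {..<n}.\<close>
definition vec_space :: "nat \<Rightarrow> (nat \<Rightarrow> real) measure" where
  "vec_space n = PiM {..<n} (\<lambda>_. borel)"

definition gauss_vec :: "nat \<Rightarrow> (nat \<Rightarrow> real) measure" where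
  "gauss_vec n = PiM {..<n} (\<lambda>_. std_gauss)"

definition admissible_encoder :: "nat \<Rightarrow> ((nat \<Rightarrow> real) \<Rightarrow> (nat \<Rightarrow> real)) \<Rightarrow> bool" where
  "admissible_encoder n f \<longleftrightarrow>
     f \<in> vec_space n \<rightarrow>\<^sub>M vec_space n \<and>
     (\<integral>\<^sup>+ s. ennreal (\<Sum>i<n. (f s i)\<^sup>2) \<partial>gauss_vec n) \<le> ennreal (real n)"

text \<open>Decoders: measurable maps of (Y^n, T^n, H_c, Gamma_c) to R^n.\<close>
definition admissible_decoder ::
  "nat \<Rightarrow> ((nat \<Rightarrow> real) \<times> (nat \<Rightarrow> real) \<times> real \<times> real \<Rightarrow> (nat \<Rightarrow> real)) \<Rightarrow> bool" where
  "admissible_decoder n g \<longleftrightarrow>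
     g \<in> (vec_space n \<Otimes>\<^sub>M vec_space n \<Otimes>\<^sub>M borel \<Otimes>\<^sub>M borel) \<rightarrow>\<^sub>M vec_space n"

text \<open>Joint law of (S^n, N^n, Z^n, H_c, Gamma_c): independent components.
  muH, muG are the laws of the fading coefficients H_c, Gamma_c.\<close>
definition joint_law ::
  "nat \<Rightarrow> real measure \<Rightarrow> real measure \<Rightarrow>
   ((nat \<Rightarrow> real) \<times> (nat \<Rightarrow> real) \<times> (nat \<Rightarrow> real) \<times> real \<times> real) measure" where
  "joint_law n muH muG =
     gauss_vec n \<Otimes>\<^sub>M gauss_vec n \<Otimes>\<^sub>M gauss_vec n \<Otimes>\<^sub>M muH \<Otimes>\<^sub>M muG"

definition exp_distortion ::
  "nat \<Rightarrow> real measure \<Rightarrow> real measure \<Rightarrow> ((nat \<Rightarrow> real) \<Rightarrow> (nat \<Rightarrow> real)) \<Rightarrow>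
   ((nat \<Rightarrow> real) \<times> (nat \<Rightarrow> real) \<times> real \<times> real \<Rightarrow> (nat \<Rightarrow> real)) \<Rightarrow> ennreal" where
  "exp_distortion n muH muG f g =
     (\<integral>\<^sup>+ \<omega>. (case \<omega> of (s, w, z, hc, gc) \<Rightarrow>
        let Y = (\<lambda>i\<in>{..<n}. hc * f s i + w i);
            T = (\<lambda>i\<in>{..<n}. gc * s i + z i);
            Shat = g (Y, T, hc, gc)
        in ennreal ((1 / real n) * (\<Sum>i<n. (s i - Shat i)\<^sup>2)))
      \<partial>joint_law n muH muG)"

text \<open>Optimal expected distortion ED^*, with lim taken as liminf in n.\<close>
definition opt_exp_distortion :: "real measure \<Rightarrow> real measure \<Rightarrow> real" where
  "opt_exp_distortion muH muG =
     enn2real (liminf (\<lambda>n. INF fg \<in> {(f, g). admissible_encoder n f \<and> admissible_decoder n g}.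
                              exp_distortion n muH muG (fst fg) (snd fg)))"

text \<open>Nakagami model at SNR rho: H_c = sqrt rho * H_c0, Gamma_c = sqrt rho * G_c0, where
  H_c0^2 ~ Gamma(L_c, 1/L_c) and G_c0^2 ~ Gamma(L_s, 1/L_s) (laws mu0H, mu0G).\<close>
definition ED_nakagami :: "real measure \<Rightarrow> real measure \<Rightarrow> real \<Rightarrow> real" where
  "ED_nakagami mu0H mu0G \<rho> =
     opt_exp_distortion (distr mu0H borel (\<lambda>x. sqrt \<rho> * x)) (distr mu0G borel (\<lambda>x. sqrt \<rho> * x))"

definition pos_part :: "real \<Rightarrow> real" where
  "pos_part x = max 0 x"

definition Delta_pe :: "real \<Rightarrow> real \<Rightarrow> real" where
  "Delta_pe Ls Lc = 1 + pos_part (1 - 1 / Ls)"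

definition Delta_inf :: "real \<Rightarrow> real \<Rightarrow> real" where
  "Delta_inf Ls Lc = min Lc 1 + min Ls 1"

definition Ls_threshold :: "real \<Rightarrow> ereal" where
  "Ls_threshold Lc = (if pos_part (1 - Lc) = 0 then \<infinity> else ereal (1 / pos_part (1 - Lc)))"

definition Delta_cases :: "real \<Rightarrow> real \<Rightarrow> real" where
  "Delta_cases Ls Lc =
     (if Ls \<le> 1 then min 1 (Ls + Lc)
      else if ereal Ls \<le> Ls_threshold Lc then 2 - 1 / Ls
      else 1 + Lc)"

end

theory Submission
  imports Defs
begin

text \<open>Write Y for the channel output and let T_1, ..., T_M be side informations with gains g_1, ..., g_M,
conditionally independent given the source S. The true joint density of (S, Y, T_1, ..., T_M) is compared
with a second probability density, built from Gaussian conditional densities: Y is centred with variance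
1 + h^2, each T_(k+1) is centred at g_(k+1) times the decoder estimate of S from (Y, T_k), with variance
1 + g_(k+1)^2 D_k, and S is centred at the decoder estimate from (Y, T_M), with variance D_M. Nonnegativity of
the relative entropy, where every logarithm is an explicit quadratic, gives up to a factor e^(M+1)
the inequality 1 <= (1 + h^2) (1 + g_1^2) (1 + g_2^2 D_1) ... (1 + g_M^2 D_(M-1)) D_M.

For M = 1 this is the informed encoder bound D >= c / ((1 + h^2) (1 + g^2)), whose average over the fading
has exponent Delta_inf. For Delta_pe put a = min(1, 1 / L_s), fix h^2 of order rho, and let g_k^2
climb from rho^(1-a) to rho in steps rho^(a/M). If the expected distortion were below rho^(-(2-a)-eps), Markov's
inequality would yield gains for which all intermediate factors are bounded, and the product
would tend to 0.\<close>

section \<open>Gaussian change of measure\<close>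

text \<open>For one fixed pair of gains a code may come close to the informed encoder bound, so no
  argument at a single pair can detect that the encoder ignores the side-information gain. Different
  gains are coupled because the channel output Y is the same whatever the gain: one Y serves all the
  T_k, and the decoder used at gain g_k is an estimator from (Y, T_k). If g_(k+1)^2 D_k stays
  bounded, T_(k+1) multiplies the product by a constant only, so climbing to gain rho costs just the
  first factor 1 + g_1^2, of order rho^(1-a). The value of a comes from Markov's inequality. A
  squared gain of order rho theta has probability of order at least theta^(L_s), so expected
  distortion E allows D of order E theta^(-L_s), and the next factor exceeds 1 by about rho^(1+a/M)
  E theta^(1-L_s). With E = rho^(-(2-a)-eps) this is bounded if theta^(1-L_s) is at most of order
  rho^(1-a) for all theta between rho^(-a) and 1. For L_s > 1 that means a (L_s - 1) <= 1 - a, and a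
  = 1 / L_s is the largest solution; for L_s <= 1 the choice a = 1 works.\<close>

lemma gibbs_exponent_nonpos:
  fixes A B :: "'a \<Rightarrow> real"
  assumes "prob_space M"
    and [measurable]: "A \<in> borel_measurable M" "B \<in> borel_measurable M"
    and A0: "\<And>x. 0 \<le> A x" and B0: "\<And>x. 0 \<le> B x"
    and \<alpha>: "(\<integral>\<^sup>+x. ennreal (A x) \<partial>M) = ennreal \<alpha>" "0 \<le> \<alpha>"
    and \<beta>: "(\<integral>\<^sup>+x. ennreal (B x) \<partial>M) \<le> ennreal \<beta>" "0 \<le> \<beta>"
    and R: "(\<integral>\<^sup>+x. ennreal (exp (c + A x - B x)) \<partial>M) \<le> 1"
  shows "c + \<alpha> - \<beta> \<le> 0"
proof -
  interpret prob_space M by fact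
  have iA: "integrable M A" "(\<integral>x. A x \<partial>M) = \<alpha>"
    using A0 \<alpha> by (auto simp: integrable_iff_bounded integral_eq_nn_integral)
  have iB: "integrable M B"
    using B0 \<beta> le_less_trans[OF \<beta>(1)] by (auto simp: integrable_iff_bounded)
  have B: "(\<integral>x. B x \<partial>M) \<le> \<beta>"
    using B0 \<beta> by (simp add: integral_eq_nn_integral enn2real_leI)
  have iR: "integrable M (\<lambda>x. exp (c + A x - B x))"
    using le_less_trans[OF R] by (auto simp: integrable_iff_bounded)
  have R': "(\<integral>x. exp (c + A x - B x) \<partial>M) \<le> 1"
    using R by (simp add: integral_eq_nn_integral enn2real_leI)
  \<comment> \<open>The tangent \<open>1 + x \<le> exp x\<close> turns the bound on the exponential
    moment into one on the mean of the exponent. For \<open>A\<close> the mean is known exactly,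
    while \<open>B\<close> enters with a minus sign, so an upper bound on its mean suffices.\<close>
  have "(\<integral>x. 1 + (c + A x - B x) \<partial>M) \<le> (\<integral>x. exp (c + A x - B x) \<partial>M)"
    by (intro integral_mono iR Bochner_Integration.integrable_add
      Bochner_Integration.integrable_diff iA iB integrable_const exp_ge_add_one_self)
  also have "(\<integral>x. 1 + (c + A x - B x) \<partial>M) = 1 + (c + \<alpha> - (\<integral>x. B x \<partial>M))"
    using iA iB by (simp add: prob_space)
  finally show ?thesis using R' B by linarith
qed

text \<open>By Fubini, coordinatewise changes of measure multiply. The families \<open>M\<close> and
  \<open>N\<close> are arbitrary because the result serves at two levels: for the entries of a
  vector, and for whole vectors as coordinates of a family of blocks. \<open>F\<close> is
  generalised in the induction, since integrating out coordinate \<open>i\<close> replaces it by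
  \<open>G\<close>.\<close>

lemma nn_integral_PiM_change_of_measure:
  assumes M: "\<And>j. sigma_finite_measure (M j)" and N: "\<And>j. sigma_finite_measure (N j)"
    and \<tau>[measurable]: "\<And>j. \<tau> j \<in> M j \<rightarrow>\<^sub>M N j"
    and \<psi>[measurable]: "\<And>j. \<psi> j \<in> borel_measurable (M j)"
    and eq: "\<And>j G. G \<in> borel_measurable (N j) \<Longrightarrow>
        (\<integral>\<^sup>+z. \<psi> j z * G (\<tau> j z) \<partial>M j) = (\<integral>\<^sup>+x. G x \<partial>N j)"
    and J: "finite J" and F: "F \<in> borel_measurable (PiM J N)"
  shows "(\<integral>\<^sup>+z. (\<Prod>j\<in>J. \<psi> j (z j)) * F (\<lambda>j\<in>J. \<tau> j (z j)) \<partial>PiM J M) = (\<integral>\<^sup>+x. F x \<partial>PiM J N)"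
  using J F
proof (induction J arbitrary: F)
  case empty
  interpret M: product_sigma_finite M by (simp add: product_sigma_finite_def M)
  interpret N: product_sigma_finite N by (simp add: product_sigma_finite_def N)
  show ?case by (simp add: PiM_empty nn_integral_count_space_finite restrict_def)
next
  case (insert i J)
  interpret M: product_sigma_finite M by (simp add: product_sigma_finite_def M)
  interpret N: product_sigma_finite N by (simp add: product_sigma_finite_def N)
  interpret Mi: sigma_finite_measure "M i" by (rule M)
  interpret Ni: sigma_finite_measure "N i" by (rule N)
  note insert.hyps(1)[simp] insert.prems[measurable]
  define G where "G x = (\<integral>\<^sup>+y. F (x(i := y)) \<partial>N i)" for x
  have [measurable]: "(\<lambda>(x, y). F (x(i := y))) \<in> borel_measurable (PiM J N \<Otimes>\<^sub>M N i)"
    by measurable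
  have Fi[measurable]: "(\<lambda>y. F (x(i := y))) \<in> borel_measurable (N i)" if "x \<in> space (PiM J N)" for x
    using that by measurable
  have [measurable]: "G \<in> borel_measurable (PiM J N)"
    unfolding G_def by measurable
  have "(\<integral>\<^sup>+z. (\<Prod>j\<in>insert i J. \<psi> j (z j)) * F (\<lambda>j\<in>insert i J. \<tau> j (z j)) \<partial>PiM (insert i J) M)
    = (\<integral>\<^sup>+z. (\<integral>\<^sup>+y. (\<Prod>j\<in>insert i J. \<psi> j ((z(i:=y)) j)) * F (\<lambda>j\<in>insert i J. \<tau> j ((z(i:=y)) j)) \<partial>M i) \<partial>PiM J M)"
    by (rule M.product_nn_integral_insert) (use insert.hyps in measurable)
  also have "\<dots> = (\<integral>\<^sup>+z. (\<Prod>j\<in>J. \<psi> j (z j)) * G (\<lambda>j\<in>J. \<tau> j (z j)) \<partial>PiM J M)"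
  proof (intro nn_integral_cong)
    fix z assume z: "z \<in> space (PiM J M)"
    then have z': "(\<lambda>j\<in>J. \<tau> j (z j)) \<in> space (PiM J N)"
      using measurable_space[OF \<tau>] by (auto simp: space_PiM)
    have "(\<integral>\<^sup>+y. (\<Prod>j\<in>insert i J. \<psi> j ((z(i:=y)) j)) * F (\<lambda>j\<in>insert i J. \<tau> j ((z(i:=y)) j)) \<partial>M i)
      = (\<integral>\<^sup>+y. (\<Prod>j\<in>J. \<psi> j (z j)) * (\<psi> i y * F ((\<lambda>j\<in>J. \<tau> j (z j))(i := \<tau> i y))) \<partial>M i)"
    proof (intro nn_integral_cong)
      fix y
      have "(\<Prod>j\<in>J. \<psi> j ((z(i:=y)) j)) = (\<Prod>j\<in>J. \<psi> j (z j))"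
        using insert.hyps by (intro prod.cong) auto
      moreover have "(\<lambda>j\<in>insert i J. \<tau> j ((z(i:=y)) j)) = (\<lambda>j\<in>J. \<tau> j (z j))(i := \<tau> i y)"
        using insert.hyps by (auto simp: fun_eq_iff)
      ultimately show "(\<Prod>j\<in>insert i J. \<psi> j ((z(i:=y)) j)) * F (\<lambda>j\<in>insert i J. \<tau> j ((z(i:=y)) j))
        = (\<Prod>j\<in>J. \<psi> j (z j)) * (\<psi> i y * F ((\<lambda>j\<in>J. \<tau> j (z j))(i := \<tau> i y)))"
        using insert.hyps by (simp add: ac_simps)
    qed
    also have "\<dots> = (\<Prod>j\<in>J. \<psi> j (z j)) * (\<integral>\<^sup>+y. \<psi> i y * F ((\<lambda>j\<in>J. \<tau> j (z j))(i := \<tau> i y)) \<partial>M i)"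
      by (intro nn_integral_cmult) (use measurable_compose[OF \<tau> Fi[OF z']] in measurable)
    also have "\<dots> = (\<Prod>j\<in>J. \<psi> j (z j)) * G (\<lambda>j\<in>J. \<tau> j (z j))"
      unfolding G_def by (subst eq[OF Fi[OF z']]) simp
    finally show "(\<integral>\<^sup>+y. (\<Prod>j\<in>insert i J. \<psi> j ((z(i:=y)) j)) * F (\<lambda>j\<in>insert i J. \<tau> j ((z(i:=y)) j)) \<partial>M i)
      = (\<Prod>j\<in>J. \<psi> j (z j)) * G (\<lambda>j\<in>J. \<tau> j (z j))" .
  qed
  also have "\<dots> = (\<integral>\<^sup>+x. G x \<partial>PiM J N)"
    by (rule insert.IH) measurable
  also have "\<dots> = (\<integral>\<^sup>+x. F x \<partial>PiM (insert i J) N)"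
    unfolding G_def by (rule N.product_nn_integral_insert[symmetric]) (use insert.hyps in measurable)
  finally show ?case .
qed

section \<open>Gaussian vectors compared with Lebesgue measure\<close>

lemma prob_space_std_gauss: "prob_space std_gauss"
  unfolding std_gauss_def by (rule prob_space_normal_density) simp

lemma sets_std_gauss [simp, measurable_cong]: "sets std_gauss = sets borel"
  by (simp add: std_gauss_def)

lemma sets_vec_space [measurable_cong]: "sets (vec_space n) = sets (PiM {..<n} (\<lambda>_. borel))"
  by (simp add: vec_space_def)

lemma sets_gauss_vec [simp, measurable_cong]: "sets (gauss_vec n) = sets (vec_space n)"
  unfolding gauss_vec_def vec_space_def by (intro sets_PiM_cong) auto

lemma prob_space_gauss_vec: "prob_space (gauss_vec n)"
  unfolding gauss_vec_def by (intro prob_space_PiM prob_space_std_gauss)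

definition lborel_vec :: "nat \<Rightarrow> (nat \<Rightarrow> real) measure" where
  "lborel_vec n = PiM {..<n} (\<lambda>_. lborel)"

lemma sets_lborel_vec [simp, measurable_cong]: "sets (lborel_vec n) = sets (vec_space n)"
  unfolding lborel_vec_def vec_space_def by (intro sets_PiM_cong) auto

lemma sigma_finite_lborel_vec: "sigma_finite_measure (lborel_vec n)"
  unfolding lborel_vec_def
  by (rule product_sigma_finite.sigma_finite)
     (simp_all add: product_sigma_finite_def sigma_finite_lborel)

lemma sigma_finite_gauss_vec: "sigma_finite_measure (gauss_vec n)"
  using prob_space_gauss_vec prob_space_imp_sigma_finite by blast

lemma vec_space_component [measurable]:
  "i < n \<Longrightarrow> (\<lambda>x. x i) \<in> borel_measurable (vec_space n)"
  unfolding vec_space_def by (rule measurable_component_singleton) simp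

lemma measurable_vec_spaceI:
  assumes "\<And>i. i < n \<Longrightarrow> (\<lambda>x. f x i) \<in> borel_measurable M"
  shows "(\<lambda>x. \<lambda>i\<in>{..<n}. f x i) \<in> M \<rightarrow>\<^sub>M vec_space n"
  unfolding vec_space_def by (rule measurable_restrict) (use assms in auto)

text \<open>The weight is evaluated at the noise \<open>z\<close>, so it cancels the density of
  \<open>z\<close> whatever the shift is, and translation invariance then removes \<open>m\<close>.
  Later \<open>m\<close> may therefore depend on an already fixed source vector.\<close>

lemma nn_integral_std_gauss_shift:
  assumes [measurable]: "G \<in> borel_measurable borel"
  shows "(\<integral>\<^sup>+z. ennreal (1 / std_normal_density z) * G (m + z) \<partial>std_gauss) = (\<integral>\<^sup>+x. G x \<partial>lborel)"
proof -
  have "(\<integral>\<^sup>+z. ennreal (1 / std_normal_density z) * G (m + z) \<partial>std_gauss)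
    = (\<integral>\<^sup>+z. ennreal (std_normal_density z) * (ennreal (1 / std_normal_density z) * G (m + z)) \<partial>lborel)"
    unfolding std_gauss_def by (subst nn_integral_density) auto
  also have "\<dots> = (\<integral>\<^sup>+z. G (m + z) \<partial>lborel)"
  proof (intro nn_integral_cong)
    fix z
    have "0 < std_normal_density z" by (rule normal_density_pos) simp
    then have "ennreal (std_normal_density z) * ennreal (1 / std_normal_density z) = 1"
      by (simp add: ennreal_mult[symmetric])
    then show "ennreal (std_normal_density z) * (ennreal (1 / std_normal_density z) * G (m + z)) = G (m + z)"
      by (metis mult.assoc mult_1)
  qed
  also have "\<dots> = (\<integral>\<^sup>+x. G x \<partial>lborel)"
    using nn_integral_real_affine[of G 1 m] by simp
  finally show ?thesis .
qed

lemma nn_integral_gauss_vec_shift: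
  assumes [measurable]: "G \<in> borel_measurable (vec_space n)"
  shows "(\<integral>\<^sup>+z. (\<Prod>i<n. ennreal (1 / std_normal_density (z i))) * G (\<lambda>i\<in>{..<n}. m i + z i) \<partial>gauss_vec n)
    = (\<integral>\<^sup>+x. G x \<partial>lborel_vec n)"
  unfolding gauss_vec_def lborel_vec_def
  by (rule nn_integral_PiM_change_of_measure)
     (auto simp: prob_space_imp_sigma_finite prob_space_std_gauss sigma_finite_lborel
       vec_space_def[symmetric] lborel_vec_def[symmetric] measurable_cong_sets[OF sets_lborel_vec refl]
       measurable_cong_sets[OF sets_std_gauss refl] nn_integral_std_gauss_shift)

text \<open>The parameter \<open>v\<close> is a variance, not a standard deviation, so that the
  final bound is a plain product of such parameters.\<close>

definition vec_normal_density :: "nat \<Rightarrow> (nat \<Rightarrow> real) \<Rightarrow> real \<Rightarrow> (nat \<Rightarrow> real) \<Rightarrow> real" where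
  "vec_normal_density n \<mu> v x = (\<Prod>i<n. normal_density (\<mu> i) (sqrt v) (x i))"

lemma nn_integral_vec_normal_density:
  assumes "0 < v"
  shows "(\<integral>\<^sup>+x. ennreal (vec_normal_density n \<mu> v x) \<partial>lborel_vec n) = 1"
proof -
  interpret product_sigma_finite "\<lambda>_::nat. lborel :: real measure"
    by (simp add: product_sigma_finite_def sigma_finite_lborel)
  have 1: "(\<integral>\<^sup>+x. ennreal (normal_density (\<mu> i) (sqrt v) x) \<partial>lborel) = 1" for i
    using assms by (simp add: nn_integral_eq_integral)
  have "(\<integral>\<^sup>+x. (\<Prod>i<n. ennreal (normal_density (\<mu> i) (sqrt v) (x i))) \<partial>lborel_vec n) = (\<Prod>i<n. 1)"
    unfolding lborel_vec_def by (subst product_nn_integral_prod) (auto simp: 1)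
  then show ?thesis
    by (simp add: vec_normal_density_def prod_ennreal)
qed

text \<open>The factors \<open>sqrt (2 * pi)\<close> cancel. The exponent retains half the
  log-variance and two squares, whose means are second moments.\<close>

lemma normal_density_ratio:
  assumes "0 < v"
  shows "1 / std_normal_density z * normal_density a (sqrt v) x
    = exp (- ln v / 2 + z\<^sup>2 / 2 - (x - a)\<^sup>2 / (2 * v))"
proof -
  have "exp (- ln v / 2) = 1 / sqrt v"
    using assms exp_minus[of "ln (sqrt v)"] exp_ln[of "sqrt v"] by (simp add: ln_sqrt inverse_eq_divide)
  moreover have "1 / std_normal_density z = sqrt (2 * pi) * exp (z\<^sup>2 / 2)"
    by (simp add: std_normal_density_def exp_minus field_simps)
  moreover have "normal_density a (sqrt v) x = 1 / (sqrt (2 * pi) * sqrt v) * exp (- ((x - a)\<^sup>2 / (2 * v)))"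
    using assms by (simp add: normal_density_def real_sqrt_mult)
  moreover have "exp (- ln v / 2 + z\<^sup>2 / 2 - (x - a)\<^sup>2 / (2 * v))
    = exp (- ln v / 2) * exp (z\<^sup>2 / 2) * exp (- ((x - a)\<^sup>2 / (2 * v)))"
    by (simp add: mult_exp_exp)
  ultimately show ?thesis by simp
qed

lemma borel_measurable_normal_density_comp [measurable]:
  assumes [measurable]: "f \<in> borel_measurable M" "g \<in> borel_measurable M"
  shows "(\<lambda>\<omega>. normal_density (f \<omega>) \<sigma> (g \<omega>)) \<in> borel_measurable M"
  unfolding normal_density_def by measurable

section \<open>Families of noise blocks and sequential densities\<close>

abbreviation obs_space :: "nat \<Rightarrow> nat \<Rightarrow> (nat \<Rightarrow> nat \<Rightarrow> real) measure" where
  "obs_space n K \<equiv> PiM {..<K} (\<lambda>_. vec_space n)"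

abbreviation gauss_blocks :: "nat \<Rightarrow> nat \<Rightarrow> (nat \<Rightarrow> nat \<Rightarrow> real) measure" where
  "gauss_blocks n K \<equiv> PiM {..<K} (\<lambda>_. gauss_vec n)"

lemma sets_gauss_blocks [measurable_cong]: "sets (gauss_blocks n K) = sets (obs_space n K)"
  by (intro sets_PiM_cong) auto

lemma sets_lborel_blocks [measurable_cong]:
  "sets (PiM {..<K} (\<lambda>_. lborel_vec n)) = sets (obs_space n K)"
  by (intro sets_PiM_cong) auto

lemma prob_space_gauss_blocks: "prob_space (gauss_blocks n K)"
  by (intro prob_space_PiM prob_space_gauss_vec)

lemma obs_space_component [measurable]:
  "k < K \<Longrightarrow> i < n \<Longrightarrow> (\<lambda>x. x k i) \<in> borel_measurable (obs_space n K)"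
  using measurable_compose[OF measurable_component_singleton[of k "{..<K}" "\<lambda>_. vec_space n"]
    vec_space_component[of i n]] by simp

lemma nn_integral_gauss_blocks_shift:
  assumes "G \<in> borel_measurable (obs_space n K)"
  shows "(\<integral>\<^sup>+z. (\<Prod>k<K. \<Prod>i<n. ennreal (1 / std_normal_density (z k i)))
            * G (\<lambda>k\<in>{..<K}. \<lambda>i\<in>{..<n}. m k i + z k i) \<partial>gauss_blocks n K)
    = (\<integral>\<^sup>+x. G x \<partial>PiM {..<K} (\<lambda>_. lborel_vec n))"
proof (rule nn_integral_PiM_change_of_measure)
  show "(\<lambda>z. \<lambda>i\<in>{..<n}. m k i + z i) \<in> gauss_vec n \<rightarrow>\<^sub>M lborel_vec n" for k
    unfolding measurable_cong_sets[OF refl sets_lborel_vec] by (rule measurable_vec_spaceI) measurable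
next
  show "(\<integral>\<^sup>+z. (\<Prod>i<n. ennreal (1 / std_normal_density (z i))) * H (\<lambda>i\<in>{..<n}. m k i + z i) \<partial>gauss_vec n)
      = integral\<^sup>N (lborel_vec n) H" if "H \<in> borel_measurable (lborel_vec n)" for k H
    using that by (intro nn_integral_gauss_vec_shift) (simp add: measurable_cong_sets[OF sets_lborel_vec refl])
qed (use assms in \<open>simp_all add: sigma_finite_gauss_vec sigma_finite_lborel_vec
    measurable_cong_sets[OF sets_lborel_blocks refl]\<close>)

text \<open>The hypothesis on \<open>x(j := y)\<close> says that the prediction \<open>a k\<close>
  reads only blocks before \<open>k\<close>. The product is thus a chain of conditional densities,
  and the last block can be integrated out first. Measurability is asked over every
  \<open>obs_space n K\<close> with \<open>k < K\<close> because the induction changes the length of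
  the family.\<close>

lemma nn_integral_sequential_normal_density:
  assumes v: "\<And>k. 0 < v k"
    and a: "\<And>k j x y. k \<le> j \<Longrightarrow> a k (x(j := y)) = a k x"
    and a_meas [measurable]:
      "\<And>k i K. k < K \<Longrightarrow> i < n \<Longrightarrow> (\<lambda>x. a k x i) \<in> borel_measurable (obs_space n K)"
  shows "(\<integral>\<^sup>+x. (\<Prod>k<K. ennreal (vec_normal_density n (a k x) (v k) (x k)))
            \<partial>PiM {..<K} (\<lambda>_. lborel_vec n)) = 1"
proof (induction K)
  case 0
  show ?case by (simp add: PiM_empty nn_integral_count_space_finite)
next
  case (Suc K)
  interpret product_sigma_finite "\<lambda>_::nat. lborel_vec n"
    by (simp add: product_sigma_finite_def sigma_finite_lborel_vec)
  let ?L = "\<lambda>K. PiM {..<K} (\<lambda>_. lborel_vec n)"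
  have [measurable]: "(\<lambda>x. ennreal (vec_normal_density n (a k x) (v k) (x k))) \<in> borel_measurable (?L (Suc K))"
    if "k < Suc K" for k
    using that unfolding vec_normal_density_def by measurable
  have [measurable]: "vec_normal_density n \<mu> w \<in> borel_measurable (lborel_vec n)" for \<mu> w
    unfolding vec_normal_density_def by measurable
  have "(\<integral>\<^sup>+x. (\<Prod>k<Suc K. ennreal (vec_normal_density n (a k x) (v k) (x k))) \<partial>?L (Suc K))
    = (\<integral>\<^sup>+x. (\<integral>\<^sup>+y. (\<Prod>k<Suc K. ennreal (vec_normal_density n (a k (x(K := y))) (v k) ((x(K := y)) k)))
         \<partial>lborel_vec n) \<partial>?L K)"
    unfolding lessThan_Suc[of K]
    by (rule product_nn_integral_insert) (auto intro!: borel_measurable_prod_ennreal simp: lessThan_Suc[symmetric])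
  also have "\<dots> = (\<integral>\<^sup>+x. (\<Prod>k<K. ennreal (vec_normal_density n (a k x) (v k) (x k))) \<partial>?L K)"
  proof (intro nn_integral_cong)
    fix x
    have "(\<integral>\<^sup>+y. (\<Prod>k<Suc K. ennreal (vec_normal_density n (a k (x(K := y))) (v k) ((x(K := y)) k))) \<partial>lborel_vec n)
      = (\<integral>\<^sup>+y. (\<Prod>k<K. ennreal (vec_normal_density n (a k x) (v k) (x k)))
          * ennreal (vec_normal_density n (a K x) (v K) y) \<partial>lborel_vec n)"
    proof (intro nn_integral_cong)
      fix y
      have "a k (x(K := y)) = a k x" if "k < Suc K" for k
        using that by (intro a) simp
      then show "(\<Prod>k<Suc K. ennreal (vec_normal_density n (a k (x(K := y))) (v k) ((x(K := y)) k)))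
        = (\<Prod>k<K. ennreal (vec_normal_density n (a k x) (v k) (x k)))
          * ennreal (vec_normal_density n (a K x) (v K) y)"
        by (simp add: mult.commute)
    qed
    also have "\<dots> = (\<Prod>k<K. ennreal (vec_normal_density n (a k x) (v k) (x k)))"
      by (subst nn_integral_cmult) (auto simp: nn_integral_vec_normal_density v)
    finally show "(\<integral>\<^sup>+y. (\<Prod>k<Suc K. ennreal (vec_normal_density n (a k (x(K := y))) (v k) ((x(K := y)) k)))
      \<partial>lborel_vec n) = (\<Prod>k<K. ennreal (vec_normal_density n (a k x) (v k) (x k)))" .
  qed
  also have "\<dots> = 1" by (rule Suc.IH)
  finally show ?case .
qed

lemma vec_normal_density_ratio:
  assumes "0 < v"
  shows "(\<Prod>i<n. ennreal (1 / std_normal_density (z i))) * ennreal (vec_normal_density n a v x)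
    = ennreal (exp (- (real n * ln v / 2) + (\<Sum>i<n. (z i)\<^sup>2) / 2 - (\<Sum>i<n. (x i - a i)\<^sup>2) / (2 * v)))"
proof -
  have "(\<Prod>i<n. ennreal (1 / std_normal_density (z i))) * ennreal (vec_normal_density n a v x)
    = ennreal (\<Prod>i<n. 1 / std_normal_density (z i) * normal_density (a i) (sqrt v) (x i))"
    unfolding vec_normal_density_def
    by (subst prod_ennreal) (auto simp: ennreal_mult[symmetric] prod_nonneg simp flip: prod.distrib)
  also have "\<dots> = ennreal (exp (\<Sum>i<n. - ln v / 2 + (z i)\<^sup>2 / 2 - (x i - a i)\<^sup>2 / (2 * v)))"
    by (simp only: normal_density_ratio[OF assms] exp_sum finite_lessThan)
  also have "(\<Sum>i<n. - ln v / 2 + (z i)\<^sup>2 / 2 - (x i - a i)\<^sup>2 / (2 * v))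
    = - (real n * ln v / 2) + (\<Sum>i<n. (z i)\<^sup>2) / 2 - (\<Sum>i<n. (x i - a i)\<^sup>2) / (2 * v)"
    by (simp add: sum.distrib sum_subtractf sum_divide_distrib)
  finally show ?thesis .
qed

section \<open>Second moments and marginals of the noise\<close>

lemma nn_integral_std_gauss_square: "(\<integral>\<^sup>+z. ennreal (z\<^sup>2) \<partial>std_gauss) = 1"
proof -
  have "(\<integral>\<^sup>+z. ennreal (z\<^sup>2) \<partial>std_gauss) = (\<integral>\<^sup>+z. ennreal (std_normal_density z * z\<^sup>2) \<partial>lborel)"
    unfolding std_gauss_def by (subst nn_integral_density) (auto simp: ennreal_mult)
  also have "\<dots> = ennreal (\<integral>z. std_normal_density z * z\<^sup>2 \<partial>lborel)"
    using std_normal_moment_even[of 1]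
    by (intro nn_integral_eq_integral) (auto simp: has_bochner_integral_iff)
  also have "\<dots> = 1" using integral_std_normal_moment_even[of 1] by (simp add: fact_numeral)
  finally show ?thesis .
qed

lemma nn_integral_gauss_vec_square: "(\<integral>\<^sup>+s. ennreal (\<Sum>i<n. (s i)\<^sup>2) \<partial>gauss_vec n) = ennreal (real n)"
proof -
  have "(\<integral>\<^sup>+s. ennreal ((s i)\<^sup>2) \<partial>gauss_vec n) = 1" if "i < n" for i
  proof -
    have "(\<integral>\<^sup>+s. ennreal ((s i)\<^sup>2) \<partial>gauss_vec n)
      = (\<integral>\<^sup>+x. ennreal (x\<^sup>2) \<partial>distr (gauss_vec n) std_gauss (\<lambda>s. s i))"
      using that by (subst nn_integral_distr) (auto simp: measurable_cong_sets[OF refl sets_std_gauss] measurable_cong_sets[OF sets_std_gauss refl])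
    also have "distr (gauss_vec n) std_gauss (\<lambda>s. s i) = std_gauss"
      unfolding gauss_vec_def
      by (rule distr_PiM_component[where M="\<lambda>_. std_gauss"]) (use that prob_space_std_gauss in auto)
    finally show ?thesis by (simp add: nn_integral_std_gauss_square)
  qed
  then have "(\<Sum>i<n. \<integral>\<^sup>+s. ennreal ((s i)\<^sup>2) \<partial>gauss_vec n) = ennreal (real n)"
    by (simp add: ennreal_of_nat_eq_real_of_nat)
  moreover have "(\<integral>\<^sup>+s. (\<Sum>i<n. ennreal ((s i)\<^sup>2)) \<partial>gauss_vec n) = (\<Sum>i<n. \<integral>\<^sup>+s. ennreal ((s i)\<^sup>2) \<partial>gauss_vec n)"
    by (rule nn_integral_sum) auto
  ultimately show ?thesis by simp
qed

lemma nn_integral_gauss_blocks_component: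
  assumes "k < K" and [measurable]: "G \<in> borel_measurable (vec_space n)"
  shows "(\<integral>\<^sup>+z. G (z k) \<partial>gauss_blocks n K) = (\<integral>\<^sup>+w. G w \<partial>gauss_vec n)"
proof -
  have "(\<integral>\<^sup>+z. G (z k) \<partial>gauss_blocks n K)
    = (\<integral>\<^sup>+w. G w \<partial>distr (gauss_blocks n K) (gauss_vec n) (\<lambda>z. z k))"
    using assms by (subst nn_integral_distr) auto
  also have "distr (gauss_blocks n K) (gauss_vec n) (\<lambda>z. z k) = gauss_vec n"
    by (rule distr_PiM_component[where M="\<lambda>_. gauss_vec n"]) (use assms prob_space_gauss_vec in auto)
  finally show ?thesis .
qed

text \<open>A decoder using one side information meets only the channel noise, stored in block 0,
  and the noise of block \<open>k\<close>. The remaining blocks integrate to 1, so its error in the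
  joint experiment is that of a model with two noises.\<close>

lemma nn_integral_gauss_blocks_pair:
  assumes "0 < k" "k < K"
    and [measurable]: "(\<lambda>(w, z). G w z) \<in> borel_measurable (vec_space n \<Otimes>\<^sub>M vec_space n)"
  shows "(\<integral>\<^sup>+z. G (z 0) (z k) \<partial>gauss_blocks n K) = (\<integral>\<^sup>+w. \<integral>\<^sup>+z. G w z \<partial>gauss_vec n \<partial>gauss_vec n)"
proof -
  interpret product_sigma_finite "\<lambda>_::nat. gauss_vec n"
    by (simp add: product_sigma_finite_def sigma_finite_gauss_vec)
  interpret G: prob_space "gauss_vec n" by (rule prob_space_gauss_vec)
  define J where "J = {..<K} - {0}"
  have K: "{..<K} = insert 0 J" and J: "finite J" "0 \<notin> J" "k \<in> J"
    using assms by (auto simp: J_def)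
  interpret J: prob_space "PiM J (\<lambda>_. gauss_vec n)"
    by (intro prob_space_PiM prob_space_gauss_vec)
  have [measurable]: "(\<lambda>z. G (z 0) (z k)) \<in> borel_measurable (PiM (insert 0 J) (\<lambda>_. gauss_vec n))"
  proof -
    have "(\<lambda>z. (z 0, z k)) \<in> PiM (insert 0 J) (\<lambda>_. gauss_vec n) \<rightarrow>\<^sub>M vec_space n \<Otimes>\<^sub>M vec_space n"
      using J by (intro measurable_Pair) (auto simp: measurable_cong_sets[OF refl sets_gauss_vec, symmetric]
        intro!: measurable_component_singleton)
    from measurable_compose[OF this assms(3)] show ?thesis by simp
  qed
  have "(\<integral>\<^sup>+z. G (z 0) (z k) \<partial>gauss_blocks n K)
    = (\<integral>\<^sup>+w. \<integral>\<^sup>+x. G w (x k) \<partial>PiM J (\<lambda>_. gauss_vec n) \<partial>gauss_vec n)"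
    unfolding K using J assms(1) by (subst product_nn_integral_insert_rev) auto
  also have "\<dots> = (\<integral>\<^sup>+w. \<integral>\<^sup>+z. G w z \<partial>gauss_vec n \<partial>gauss_vec n)"
  proof (intro nn_integral_cong)
    fix w assume "w \<in> space (gauss_vec n)"
    then have w: "w \<in> space (vec_space n)" by (simp add: sets_eq_imp_space_eq[OF sets_gauss_vec])
    have [measurable]: "G w \<in> borel_measurable (gauss_vec n)"
      using measurable_Pair2[OF assms(3) w] by simp
    have "(\<integral>\<^sup>+x. G w (x k) \<partial>PiM J (\<lambda>_. gauss_vec n))
      = (\<integral>\<^sup>+z. G w z \<partial>distr (PiM J (\<lambda>_. gauss_vec n)) (gauss_vec n) (\<lambda>x. x k))"
      using J by (subst nn_integral_distr) auto
    also have "distr (PiM J (\<lambda>_. gauss_vec n)) (gauss_vec n) (\<lambda>x. x k) = gauss_vec n"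
      by (rule distr_PiM_component[where M="\<lambda>_. gauss_vec n"]) (use J prob_space_gauss_vec in auto)
    finally show "(\<integral>\<^sup>+x. G w (x k) \<partial>PiM J (\<lambda>_. gauss_vec n)) = (\<integral>\<^sup>+z. G w z \<partial>gauss_vec n)" .
  qed
  finally show ?thesis .
qed

section \<open>Comparison with sequential Gaussian predictions\<close>

lemma nn_integral_scaled_sum:
  fixes f :: "'a \<Rightarrow> real" and g :: "nat \<Rightarrow> 'a \<Rightarrow> real"
  assumes [measurable]: "f \<in> borel_measurable M" "\<And>k. k < K \<Longrightarrow> g k \<in> borel_measurable M"
    and nonneg: "\<And>x. 0 \<le> f x" "\<And>k x. 0 \<le> g k x" "0 < c" "\<And>k. 0 < e k"
  shows "(\<integral>\<^sup>+x. ennreal ((\<Sum>k<K. g k x / e k) + f x / c) \<partial>M)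
    = (\<Sum>k<K. ennreal (1 / e k) * (\<integral>\<^sup>+x. ennreal (g k x) \<partial>M)) + ennreal (1 / c) * (\<integral>\<^sup>+x. ennreal (f x) \<partial>M)"
proof -
  have eq: "ennreal ((\<Sum>k<K. g k x / e k) + f x / c)
    = (\<Sum>k<K. ennreal (1 / e k) * ennreal (g k x)) + ennreal (1 / c) * ennreal (f x)" for x
    using nonneg
    by (simp add: ennreal_plus[symmetric] ennreal_mult'[symmetric] sum_nonneg less_imp_le del: ennreal_plus)
  have "(\<integral>\<^sup>+x. (\<Sum>k<K. ennreal (1 / e k) * ennreal (g k x)) + ennreal (1 / c) * ennreal (f x) \<partial>M)
    = (\<integral>\<^sup>+x. (\<Sum>k<K. ennreal (1 / e k) * ennreal (g k x)) \<partial>M) + (\<integral>\<^sup>+x. ennreal (1 / c) * ennreal (f x) \<partial>M)"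
    by (rule nn_integral_add) auto
  also have "(\<integral>\<^sup>+x. (\<Sum>k<K. ennreal (1 / e k) * ennreal (g k x)) \<partial>M)
    = (\<Sum>k<K. \<integral>\<^sup>+x. ennreal (1 / e k) * ennreal (g k x) \<partial>M)"
    by (rule nn_integral_sum) auto
  also have "\<dots> = (\<Sum>k<K. ennreal (1 / e k) * (\<integral>\<^sup>+x. ennreal (g k x) \<partial>M))"
    by (intro sum.cong refl nn_integral_cmult) auto
  also have "(\<integral>\<^sup>+x. ennreal (1 / c) * ennreal (f x) \<partial>M) = ennreal (1 / c) * (\<integral>\<^sup>+x. ennreal (f x) \<partial>M)"
    by (rule nn_integral_cmult) auto
  finally show ?thesis by (simp only: eq)
qed

text \<open>The true law is built source first: \<open>m k s\<close> is the noiseless part of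
  observation \<open>k\<close>, to which unit Gaussian noise is added. The comparison law goes the
  other way round: \<open>a k\<close> predicts observation \<open>k\<close> from the earlier ones
  with variance \<open>v k\<close>, and at the end \<open>b\<close> estimates the source from all
  \<open>K\<close> observations with variance \<open>d\<close>.\<close>

locale gaussian_observations =
  fixes n K :: nat and m :: "nat \<Rightarrow> (nat \<Rightarrow> real) \<Rightarrow> nat \<Rightarrow> real"
    and a :: "nat \<Rightarrow> (nat \<Rightarrow> nat \<Rightarrow> real) \<Rightarrow> nat \<Rightarrow> real" and v :: "nat \<Rightarrow> real"
    and b :: "(nat \<Rightarrow> nat \<Rightarrow> real) \<Rightarrow> nat \<Rightarrow> real" and d :: real
  assumes v_pos: "\<And>k. 0 < v k" and d_pos: "0 < d"
    and m_meas [measurable]: "\<And>k i. i < n \<Longrightarrow> (\<lambda>s. m k s i) \<in> borel_measurable (vec_space n)"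
    and a_update: "\<And>k j x y. k \<le> j \<Longrightarrow> a k (x(j := y)) = a k x"
    and a_meas [measurable]:
      "\<And>k i J. k < J \<Longrightarrow> i < n \<Longrightarrow> (\<lambda>x. a k x i) \<in> borel_measurable (obs_space n J)"
    and b_meas [measurable]: "\<And>i. i < n \<Longrightarrow> (\<lambda>x. b x i) \<in> borel_measurable (obs_space n K)"
begin

definition obs :: "(nat \<Rightarrow> real) \<Rightarrow> (nat \<Rightarrow> nat \<Rightarrow> real) \<Rightarrow> nat \<Rightarrow> nat \<Rightarrow> real" where
  "obs s z = (\<lambda>k\<in>{..<K}. \<lambda>i\<in>{..<n}. m k s i + z k i)"

lemma obs_apply: "k < K \<Longrightarrow> i < n \<Longrightarrow> obs s z k i = m k s i + z k i"
  by (simp add: obs_def)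

definition noise_law :: "((nat \<Rightarrow> real) \<times> (nat \<Rightarrow> nat \<Rightarrow> real)) measure" where
  "noise_law = gauss_vec n \<Otimes>\<^sub>M gauss_blocks n K"

lemma prob_space_noise_law: "prob_space noise_law"
proof -
  interpret G: prob_space "gauss_vec n" by (rule prob_space_gauss_vec)
  interpret B: prob_space "gauss_blocks n K" by (rule prob_space_gauss_blocks)
  interpret pair_prob_space "gauss_vec n" "gauss_blocks n K" ..
  show ?thesis unfolding noise_law_def by (rule prob_space_axioms)
qed

lemma sets_noise_law [measurable_cong]: "sets noise_law = sets (vec_space n \<Otimes>\<^sub>M obs_space n K)"
  unfolding noise_law_def by (intro sets_pair_measure_cong sets_gauss_blocks sets_gauss_vec)

lemma obs_measurable [measurable]:
  "(\<lambda>(s, z). obs s z) \<in> vec_space n \<Otimes>\<^sub>M obs_space n K \<rightarrow>\<^sub>M obs_space n K"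
proof -
  have "(\<lambda>\<omega>. \<lambda>k\<in>{..<K}. \<lambda>i\<in>{..<n}. m k (fst \<omega>) i + snd \<omega> k i)
    \<in> vec_space n \<Otimes>\<^sub>M obs_space n K \<rightarrow>\<^sub>M obs_space n K"
    by (rule measurable_restrict, rule measurable_vec_spaceI) measurable
  then show ?thesis by (simp add: obs_def case_prod_beta')
qed

definition lik :: "(nat \<Rightarrow> real) \<Rightarrow> (nat \<Rightarrow> nat \<Rightarrow> real) \<Rightarrow> ennreal" where
  "lik s x = (\<Prod>k<K. ennreal (vec_normal_density n (a k x) (v k) (x k)))
     * ennreal (vec_normal_density n (b x) d s)"

lemma lik_measurable [measurable]:
  "(\<lambda>(s, x). lik s x) \<in> borel_measurable (vec_space n \<Otimes>\<^sub>M obs_space n K)"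
  unfolding lik_def vec_normal_density_def by measurable

text \<open>Expressed through the noise, the true density of source and observations is a product of
  standard normal densities at \<open>s\<close> and \<open>z\<close>. Dividing by it turns the
  expectation under the true law into the Lebesgue integral of the comparison density, whose total
  mass is 1.\<close>

lemma nn_integral_likelihood_ratio:
  "(\<integral>\<^sup>+(s, z). (\<Prod>i<n. ennreal (1 / std_normal_density (s i)))
      * (\<Prod>k<K. \<Prod>i<n. ennreal (1 / std_normal_density (z k i))) * lik s (obs s z) \<partial>noise_law) = 1"
proof -
  let ?L = "PiM {..<K} (\<lambda>_. lborel_vec n)"
  interpret B: prob_space "gauss_blocks n K" by (rule prob_space_gauss_blocks)
  interpret V: sigma_finite_measure "lborel_vec n" by (rule sigma_finite_lborel_vec)
  interpret L: sigma_finite_measure ?L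
    by (rule product_sigma_finite.sigma_finite)
       (auto simp: product_sigma_finite_def sigma_finite_lborel_vec)
  interpret VL: pair_sigma_finite "lborel_vec n" ?L ..
  let ?S = "\<lambda>s. \<Prod>i<n. ennreal (1 / std_normal_density (s i))"
  let ?Z = "\<lambda>z. \<Prod>k<K. \<Prod>i<n. ennreal (1 / std_normal_density (z k i))"
  have [measurable]: "lik s \<in> borel_measurable (obs_space n K)" if "s \<in> space (vec_space n)" for s
    using measurable_Pair2[OF lik_measurable that] by simp
  have "(\<integral>\<^sup>+(s, z). ?S s * ?Z z * lik s (obs s z) \<partial>noise_law)
    = (\<integral>\<^sup>+s. \<integral>\<^sup>+z. ?S s * ?Z z * lik s (obs s z) \<partial>gauss_blocks n K \<partial>gauss_vec n)"
    unfolding noise_law_def by (subst B.nn_integral_fst[symmetric]) auto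
  also have "\<dots> = (\<integral>\<^sup>+s. ?S s * (\<integral>\<^sup>+x. lik s x \<partial>?L) \<partial>gauss_vec n)"
  proof (intro nn_integral_cong)
    fix s assume "s \<in> space (gauss_vec n)"
    then have s [measurable]: "s \<in> space (vec_space n)"
      by (simp add: sets_eq_imp_space_eq[OF sets_gauss_vec])
    have [measurable]: "obs s \<in> obs_space n K \<rightarrow>\<^sub>M obs_space n K"
      using measurable_Pair2[OF obs_measurable s] by simp
    have "(\<integral>\<^sup>+z. ?S s * ?Z z * lik s (obs s z) \<partial>gauss_blocks n K)
      = (\<integral>\<^sup>+z. ?S s * (?Z z * lik s (obs s z)) \<partial>gauss_blocks n K)"
      by (simp add: mult.assoc)
    also have "\<dots> = ?S s * (\<integral>\<^sup>+z. ?Z z * lik s (obs s z) \<partial>gauss_blocks n K)"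
      by (rule nn_integral_cmult) measurable
    also have "(\<integral>\<^sup>+z. ?Z z * lik s (obs s z) \<partial>gauss_blocks n K) = (\<integral>\<^sup>+x. lik s x \<partial>?L)"
      unfolding obs_def by (rule nn_integral_gauss_blocks_shift) measurable
    finally show "(\<integral>\<^sup>+z. ?S s * ?Z z * lik s (obs s z) \<partial>gauss_blocks n K) = ?S s * (\<integral>\<^sup>+x. lik s x \<partial>?L)" .
  qed
  \<comment> \<open>Reading \<open>s\<close> as a shift by 0 lets the shift lemma act on the source
    too. The rewriting is an equality because points of \<open>gauss_vec n\<close> are
    extensional.\<close>
  also have "\<dots> = (\<integral>\<^sup>+s. ?S s * (\<lambda>s. \<integral>\<^sup>+x. lik s x \<partial>?L) (\<lambda>i\<in>{..<n}. 0 + s i) \<partial>gauss_vec n)"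
  proof (intro nn_integral_cong)
    fix s assume "s \<in> space (gauss_vec n)"
    then have "(\<lambda>i\<in>{..<n}. 0 + s i) = s"
      by (auto simp: gauss_vec_def space_PiM)
    then show "?S s * (\<integral>\<^sup>+x. lik s x \<partial>?L) = ?S s * (\<lambda>s. \<integral>\<^sup>+x. lik s x \<partial>?L) (\<lambda>i\<in>{..<n}. 0 + s i)"
      by simp
  qed
  also have "\<dots> = (\<integral>\<^sup>+s. \<integral>\<^sup>+x. lik s x \<partial>?L \<partial>lborel_vec n)"
    by (rule nn_integral_gauss_vec_shift[of _ n "\<lambda>_. 0"]) measurable
  \<comment> \<open>After the swap \<open>s\<close> is the inner variable. The comparison density
    integrates to 1 in \<open>s\<close> for fixed \<open>x\<close>, and what remains is the
    sequential density of the observations.\<close>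
  also have "\<dots> = (\<integral>\<^sup>+x. \<integral>\<^sup>+s. lik s x \<partial>lborel_vec n \<partial>?L)"
    by (rule VL.Fubini'[symmetric]) measurable
  also have "\<dots> = (\<integral>\<^sup>+x. (\<Prod>k<K. ennreal (vec_normal_density n (a k x) (v k) (x k))) \<partial>?L)"
  proof (intro nn_integral_cong)
    fix x
    have [measurable]: "vec_normal_density n \<mu> w \<in> borel_measurable (lborel_vec n)" for \<mu> w
      unfolding vec_normal_density_def by measurable
    show "(\<integral>\<^sup>+s. lik s x \<partial>lborel_vec n) = (\<Prod>k<K. ennreal (vec_normal_density n (a k x) (v k) (x k)))"
      unfolding lik_def by (subst nn_integral_cmult) (auto simp: nn_integral_vec_normal_density d_pos)
  qed
  also have "\<dots> = 1"
    by (rule nn_integral_sequential_normal_density) (use v_pos a_update a_meas in auto)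
  finally show ?thesis .
qed

text \<open>The exponent is sorted into the three pieces that \<open>gibbs_exponent_nonpos\<close>
  expects: a constant, the energy of noise and source, whose mean is known, and a weighted
  prediction error, whose mean will be bounded.\<close>

lemma likelihood_ratio_eq_exp:
  "(\<Prod>i<n. ennreal (1 / std_normal_density (s i)))
      * (\<Prod>k<K. \<Prod>i<n. ennreal (1 / std_normal_density (z k i))) * lik s x
   = ennreal (exp (- (real n * ((\<Sum>k<K. ln (v k)) + ln d) / 2)
       + ((\<Sum>k<K. (\<Sum>i<n. (z k i)\<^sup>2) / 2) + (\<Sum>i<n. (s i)\<^sup>2) / 2)
       - ((\<Sum>k<K. (\<Sum>i<n. (x k i - a k x i)\<^sup>2) / (2 * v k)) + (\<Sum>i<n. (s i - b x i)\<^sup>2) / (2 * d))))"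
  (is "?S * ?Z * _ = _")
proof -
  have "?S * ?Z * lik s x
    = (\<Prod>k<K. (\<Prod>i<n. ennreal (1 / std_normal_density (z k i))) * ennreal (vec_normal_density n (a k x) (v k) (x k)))
       * (?S * ennreal (vec_normal_density n (b x) d s))"
    unfolding lik_def by (simp add: prod.distrib ac_simps)
  also have "\<dots> = ennreal (\<Prod>k<K. exp (- (real n * ln (v k) / 2) + (\<Sum>i<n. (z k i)\<^sup>2) / 2
      - (\<Sum>i<n. (x k i - a k x i)\<^sup>2) / (2 * v k)))
    * ennreal (exp (- (real n * ln d / 2) + (\<Sum>i<n. (s i)\<^sup>2) / 2 - (\<Sum>i<n. (s i - b x i)\<^sup>2) / (2 * d)))"
    by (simp only: vec_normal_density_ratio[OF v_pos] vec_normal_density_ratio[OF d_pos] prod_ennreal exp_ge_zero)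
  also have "\<dots> = ennreal (exp ((\<Sum>k<K. - (real n * ln (v k) / 2) + (\<Sum>i<n. (z k i)\<^sup>2) / 2
      - (\<Sum>i<n. (x k i - a k x i)\<^sup>2) / (2 * v k))
     + (- (real n * ln d / 2) + (\<Sum>i<n. (s i)\<^sup>2) / 2 - (\<Sum>i<n. (s i - b x i)\<^sup>2) / (2 * d))))"
    by (simp only: exp_sum finite_lessThan ennreal_mult[symmetric] exp_ge_zero prod_nonneg exp_add)
  also have "(\<Sum>k<K. - (real n * ln (v k) / 2) + (\<Sum>i<n. (z k i)\<^sup>2) / 2
      - (\<Sum>i<n. (x k i - a k x i)\<^sup>2) / (2 * v k))
     + (- (real n * ln d / 2) + (\<Sum>i<n. (s i)\<^sup>2) / 2 - (\<Sum>i<n. (s i - b x i)\<^sup>2) / (2 * d))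
    = - (real n * ((\<Sum>k<K. ln (v k)) + ln d) / 2)
       + ((\<Sum>k<K. (\<Sum>i<n. (z k i)\<^sup>2) / 2) + (\<Sum>i<n. (s i)\<^sup>2) / 2)
       - ((\<Sum>k<K. (\<Sum>i<n. (x k i - a k x i)\<^sup>2) / (2 * v k)) + (\<Sum>i<n. (s i - b x i)\<^sup>2) / (2 * d))"
    by (simp add: sum.distrib sum_subtractf sum_negf sum_divide_distrib sum_distrib_left distrib_left add_divide_distrib)
  finally show ?thesis .
qed

lemma nn_integral_noise_source:
  "(\<integral>\<^sup>+(s, z). ennreal (\<Sum>i<n. (s i)\<^sup>2) \<partial>noise_law) = ennreal (real n)"
proof -
  interpret B: prob_space "gauss_blocks n K" by (rule prob_space_gauss_blocks)
  show ?thesis unfolding noise_law_def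
    by (subst B.nn_integral_fst[symmetric]) (auto simp: B.emeasure_space_1 nn_integral_gauss_vec_square)
qed

lemma nn_integral_noise_block:
  assumes "k < K"
  shows "(\<integral>\<^sup>+(s, z). ennreal (\<Sum>i<n. (z k i)\<^sup>2) \<partial>noise_law) = ennreal (real n)"
proof -
  interpret B: prob_space "gauss_blocks n K" by (rule prob_space_gauss_blocks)
  interpret G: prob_space "gauss_vec n" by (rule prob_space_gauss_vec)
  have "(\<integral>\<^sup>+z. ennreal (\<Sum>i<n. (z k i)\<^sup>2) \<partial>gauss_blocks n K) = ennreal (real n)"
    using nn_integral_gauss_blocks_component[OF assms, of "\<lambda>w. ennreal (\<Sum>i<n. (w i)\<^sup>2)" n]
    by (simp add: nn_integral_gauss_vec_square)
  then show ?thesis unfolding noise_law_def using assms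
    by (subst B.nn_integral_fst[symmetric]) (auto simp: G.emeasure_space_1)
qed

text \<open>The prediction errors are only required to be within a factor 2 of the variances \<^term>\<open>v k\<close>:
  this frees later estimates from cross terms, at the price of the factor \<^term>\<open>exp (real K)\<close>.\<close>

lemma variance_product_bound:
  assumes n: "0 < n"
    and pred: "\<And>k. k < K \<Longrightarrow>
      (\<integral>\<^sup>+(s, z). ennreal (\<Sum>i<n. (obs s z k i - a k (obs s z) i)\<^sup>2) \<partial>noise_law) \<le> ennreal (2 * real n * v k)"
    and est: "(\<integral>\<^sup>+(s, z). ennreal (\<Sum>i<n. (s i - b (obs s z) i)\<^sup>2) \<partial>noise_law) \<le> ennreal (real n * d)"
  shows "1 \<le> exp (real K) * (\<Prod>k<K. v k) * d"
proof -
  let ?f = "\<lambda>\<omega>. \<Sum>i<n. (fst \<omega> i)\<^sup>2" and ?g = "\<lambda>k \<omega>. \<Sum>i<n. (snd \<omega> k i)\<^sup>2"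
  let ?p = "\<lambda>k \<omega>. \<Sum>i<n. (obs (fst \<omega>) (snd \<omega>) k i - a k (obs (fst \<omega>) (snd \<omega>)) i)\<^sup>2"
  let ?e = "\<lambda>\<omega>. \<Sum>i<n. (fst \<omega> i - b (obs (fst \<omega>) (snd \<omega>)) i)\<^sup>2"
  let ?A = "\<lambda>\<omega>. (\<Sum>k<K. ?g k \<omega> / 2) + ?f \<omega> / 2"
  let ?B = "\<lambda>\<omega>. (\<Sum>k<K. ?p k \<omega> / (2 * v k)) + ?e \<omega> / (2 * d)"
  let ?c = "- (real n * ((\<Sum>k<K. ln (v k)) + ln d) / 2)"
  have [measurable]: "(\<lambda>\<omega>. obs (fst \<omega>) (snd \<omega>)) \<in> vec_space n \<Otimes>\<^sub>M obs_space n K \<rightarrow>\<^sub>M obs_space n K"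
    using obs_measurable by (simp add: case_prod_beta')
  have [measurable]: "?f \<in> borel_measurable noise_law" "?e \<in> borel_measurable noise_law"
    by measurable
  have [measurable]: "?g k \<in> borel_measurable noise_law" "?p k \<in> borel_measurable noise_law" if "k < K" for k
    using that by measurable
  have "(\<integral>\<^sup>+\<omega>. ennreal (?A \<omega>) \<partial>noise_law)
      = (\<Sum>k<K. ennreal (1 / 2) * (\<integral>\<^sup>+\<omega>. ennreal (?g k \<omega>) \<partial>noise_law))
        + ennreal (1 / 2) * (\<integral>\<^sup>+\<omega>. ennreal (?f \<omega>) \<partial>noise_law)"
    by (rule nn_integral_scaled_sum) (auto intro: sum_nonneg)
  also have "\<dots> = (\<Sum>k<K. ennreal (real n / 2)) + ennreal (real n / 2)"
  proof -
    have "ennreal (1 / 2) * ennreal (real n) = ennreal (real n / 2)"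
      using ennreal_mult[of "1 / 2" "real n", symmetric] by (simp only: times_divide_eq_left) simp
    then show ?thesis
      using nn_integral_noise_source nn_integral_noise_block by (simp add: case_prod_beta')
  qed
  also have "\<dots> = ennreal ((\<Sum>k<K. real n / 2) + real n / 2)"
    by (simp only: sum_ennreal[OF divide_nonneg_nonneg] ennreal_plus of_nat_0_le_iff zero_le_numeral
        divide_nonneg_nonneg sum_nonneg)
  finally have A: "(\<integral>\<^sup>+\<omega>. ennreal (?A \<omega>) \<partial>noise_law) = ennreal (real K * (real n / 2) + real n / 2)"
    by simp
  have "(\<integral>\<^sup>+\<omega>. ennreal (?B \<omega>) \<partial>noise_law)
      = (\<Sum>k<K. ennreal (1 / (2 * v k)) * (\<integral>\<^sup>+\<omega>. ennreal (?p k \<omega>) \<partial>noise_law))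
        + ennreal (1 / (2 * d)) * (\<integral>\<^sup>+\<omega>. ennreal (?e \<omega>) \<partial>noise_law)"
    by (rule nn_integral_scaled_sum) (auto intro: sum_nonneg simp: v_pos d_pos)
  also have "\<dots> \<le> (\<Sum>k<K. ennreal (1 / (2 * v k)) * ennreal (2 * real n * v k))
        + ennreal (1 / (2 * d)) * ennreal (real n * d)"
    using pred est by (intro add_mono sum_mono mult_left_mono) (auto simp: case_prod_beta')
  also have "\<dots> = (\<Sum>k<K. ennreal (real n)) + ennreal (real n / 2)"
    using v_pos d_pos
    by (simp add: ennreal_mult[symmetric] less_imp_le less_imp_neq[THEN not_sym] del: ennreal_divide_numeral sum_constant)
  also have "\<dots> = ennreal ((\<Sum>k<K. real n) + real n / 2)"
    by (simp only: sum_ennreal ennreal_plus of_nat_0_le_iff zero_le_numeral divide_nonneg_nonneg sum_nonneg)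
  finally have B: "(\<integral>\<^sup>+\<omega>. ennreal (?B \<omega>) \<partial>noise_law) \<le> ennreal (real K * real n + real n / 2)"
    by simp
  have R: "(\<integral>\<^sup>+\<omega>. ennreal (exp (?c + ?A \<omega> - ?B \<omega>)) \<partial>noise_law) \<le> 1"
    using nn_integral_likelihood_ratio by (simp add: likelihood_ratio_eq_exp case_prod_beta')
  \<comment> \<open>Each observation contributes \<open>n / 2\<close> through its noise energy and
    at most \<open>n\<close> through its prediction error, while the two source terms
    \<open>n / 2\<close> cancel. The deficit \<open>K * n / 2\<close> is the origin of
    \<open>exp (real K)\<close>. Every term is a multiple of \<open>n\<close>, so the final bound is
    free of the block length.\<close>
  have "?c + (real K * (real n / 2) + real n / 2) - (real K * real n + real n / 2) \<le> 0"
    by (rule gibbs_exponent_nonpos[OF prob_space_noise_law _ _ _ _ A _ B _ R])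
       (auto intro!: add_nonneg_nonneg sum_nonneg divide_nonneg_nonneg simp: less_imp_le v_pos d_pos)
  then have "real n * (- ((\<Sum>k<K. ln (v k)) + ln d) - real K) \<le> 0"
    by (simp add: algebra_simps)
  then have "0 \<le> real K + (\<Sum>k<K. ln (v k)) + ln d"
    using n by (simp add: mult_le_0_iff)
  also have "\<dots> = ln (exp (real K) * (\<Prod>k<K. v k) * d)"
    using v_pos d_pos by (simp add: ln_mult_pos prod_pos ln_prod less_imp_neq[THEN not_sym])
  finally show ?thesis
    using v_pos d_pos by (subst (asm) ln_ge_zero_iff) (auto intro!: mult_pos_pos prod_pos)
qed

end

section \<open>Distortion for fixed fading coefficients\<close>

text \<open>The decoder \<open>g\<close> receives \<open>hc\<close> and \<open>gc\<close>, the
  encoder \<open>f\<close> neither. With \<open>hc\<close> fixed, changing \<open>gc\<close>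
  therefore leaves the channel output untouched for given source and channel noise; the chain of
  side informations rests on this.\<close>

definition cond_distortion ::
  "nat \<Rightarrow> ((nat \<Rightarrow> real) \<Rightarrow> (nat \<Rightarrow> real)) \<Rightarrow>
   ((nat \<Rightarrow> real) \<times> (nat \<Rightarrow> real) \<times> real \<times> real \<Rightarrow> (nat \<Rightarrow> real)) \<Rightarrow> real \<Rightarrow> real \<Rightarrow> ennreal" where
  "cond_distortion n f g hc gc =
     (\<integral>\<^sup>+s. \<integral>\<^sup>+w. \<integral>\<^sup>+z. ennreal ((1 / real n) * (\<Sum>i<n. (s i -
        g ((\<lambda>i\<in>{..<n}. hc * f s i + w i), (\<lambda>i\<in>{..<n}. gc * s i + z i), hc, gc) i)\<^sup>2))
      \<partial>gauss_vec n \<partial>gauss_vec n \<partial>gauss_vec n)"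

lemma decoder_error_measurable:
  assumes f: "f \<in> vec_space n \<rightarrow>\<^sub>M vec_space n" and g: "admissible_decoder n g"
  shows "(\<lambda>(s, w, z, hc, gc). ennreal (c * (\<Sum>i<n. (s i -
        g ((\<lambda>i\<in>{..<n}. hc * f s i + w i), (\<lambda>i\<in>{..<n}. gc * s i + z i), hc, gc) i)\<^sup>2)))
     \<in> borel_measurable (vec_space n \<Otimes>\<^sub>M vec_space n \<Otimes>\<^sub>M vec_space n \<Otimes>\<^sub>M borel \<Otimes>\<^sub>M borel)"
proof -
  let ?M = "vec_space n \<Otimes>\<^sub>M vec_space n \<Otimes>\<^sub>M vec_space n \<Otimes>\<^sub>M borel \<Otimes>\<^sub>M (borel :: real measure)"
  have fi [measurable]: "(\<lambda>x. f x i) \<in> borel_measurable (vec_space n)" if "i < n" for i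
    using measurable_compose[OF f vec_space_component[OF that]] by simp
  have gi [measurable]: "(\<lambda>x. g x i) \<in> borel_measurable (vec_space n \<Otimes>\<^sub>M vec_space n \<Otimes>\<^sub>M borel \<Otimes>\<^sub>M borel)"
    if "i < n" for i
    using measurable_compose[OF g[unfolded admissible_decoder_def] vec_space_component[OF that]] by simp
  have [measurable]: "(\<lambda>\<omega>. \<lambda>i\<in>{..<n}. fst (snd (snd (snd \<omega>))) * f (fst \<omega>) i + fst (snd \<omega>) i) \<in> ?M \<rightarrow>\<^sub>M vec_space n"
    by (rule measurable_vec_spaceI) measurable
  have [measurable]: "(\<lambda>\<omega>. \<lambda>i\<in>{..<n}. snd (snd (snd (snd \<omega>))) * fst \<omega> i + fst (snd (snd \<omega>)) i) \<in> ?M \<rightarrow>\<^sub>M vec_space n"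
    by (rule measurable_vec_spaceI) measurable
  show ?thesis unfolding case_prod_beta' by measurable
qed

text \<open>The fading pair is the last component of the joint law. Fubini moves it past the other
  three one at a time, so that it becomes outermost and the gains can be frozen.\<close>

lemma nn_integral_pair4_rotate:
  assumes sf: "sigma_finite_measure A" "sigma_finite_measure B" "sigma_finite_measure C" "sigma_finite_measure F"
    and [measurable]: "G \<in> borel_measurable (A \<Otimes>\<^sub>M B \<Otimes>\<^sub>M C \<Otimes>\<^sub>M F)"
  shows "(\<integral>\<^sup>+\<omega>. G \<omega> \<partial>(A \<Otimes>\<^sub>M B \<Otimes>\<^sub>M C \<Otimes>\<^sub>M F))
    = (\<integral>\<^sup>+h. \<integral>\<^sup>+s. \<integral>\<^sup>+w. \<integral>\<^sup>+z. G (s, w, z, h) \<partial>C \<partial>B \<partial>A \<partial>F)"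
proof -
  interpret A: sigma_finite_measure A by fact
  interpret B: sigma_finite_measure B by fact
  interpret C: sigma_finite_measure C by fact
  interpret F: sigma_finite_measure F by fact
  interpret CF: pair_sigma_finite C F ..
  interpret BF: pair_sigma_finite B F ..
  interpret AF: pair_sigma_finite A F ..
  interpret BCF: pair_sigma_finite B "C \<Otimes>\<^sub>M F" ..
  interpret ABCF: pair_sigma_finite A "B \<Otimes>\<^sub>M C \<Otimes>\<^sub>M F" ..
  have 1: "(\<integral>\<^sup>+x. G (s, x) \<partial>(B \<Otimes>\<^sub>M C \<Otimes>\<^sub>M F)) = (\<integral>\<^sup>+h. \<integral>\<^sup>+w. \<integral>\<^sup>+z. G (s, w, z, h) \<partial>C \<partial>B \<partial>F)"
    if [measurable]: "s \<in> space A" for s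
  proof -
    have 2: "(\<integral>\<^sup>+x. G (s, w, x) \<partial>(C \<Otimes>\<^sub>M F)) = (\<integral>\<^sup>+h. \<integral>\<^sup>+z. G (s, w, z, h) \<partial>C \<partial>F)"
      if [measurable]: "w \<in> space B" for w
      by (rule CF.nn_integral_snd[symmetric]) measurable
    have "(\<integral>\<^sup>+x. G (s, x) \<partial>(B \<Otimes>\<^sub>M C \<Otimes>\<^sub>M F)) = (\<integral>\<^sup>+w. \<integral>\<^sup>+x. G (s, w, x) \<partial>(C \<Otimes>\<^sub>M F) \<partial>B)"
      by (rule CF.nn_integral_fst[symmetric]) measurable
    also have "\<dots> = (\<integral>\<^sup>+w. \<integral>\<^sup>+h. \<integral>\<^sup>+z. G (s, w, z, h) \<partial>C \<partial>F \<partial>B)"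
      by (intro nn_integral_cong 2)
    also have "\<dots> = (\<integral>\<^sup>+h. \<integral>\<^sup>+w. \<integral>\<^sup>+z. G (s, w, z, h) \<partial>C \<partial>B \<partial>F)"
      by (rule BF.Fubini'[symmetric]) measurable
    finally show ?thesis .
  qed
  have "(\<integral>\<^sup>+\<omega>. G \<omega> \<partial>(A \<Otimes>\<^sub>M B \<Otimes>\<^sub>M C \<Otimes>\<^sub>M F)) = (\<integral>\<^sup>+s. \<integral>\<^sup>+x. G (s, x) \<partial>(B \<Otimes>\<^sub>M C \<Otimes>\<^sub>M F) \<partial>A)"
    by (rule BCF.nn_integral_fst[symmetric]) measurable
  also have "\<dots> = (\<integral>\<^sup>+s. \<integral>\<^sup>+h. \<integral>\<^sup>+w. \<integral>\<^sup>+z. G (s, w, z, h) \<partial>C \<partial>B \<partial>F \<partial>A)"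
    by (intro nn_integral_cong 1)
  also have "\<dots> = (\<integral>\<^sup>+h. \<integral>\<^sup>+s. \<integral>\<^sup>+w. \<integral>\<^sup>+z. G (s, w, z, h) \<partial>C \<partial>B \<partial>A \<partial>F)"
    by (rule AF.Fubini'[symmetric]) measurable
  finally show ?thesis .
qed

lemma cond_distortion_measurable:
  assumes "f \<in> vec_space n \<rightarrow>\<^sub>M vec_space n" "admissible_decoder n g"
  shows "(\<lambda>(hc, gc). cond_distortion n f g hc gc) \<in> borel_measurable (borel \<Otimes>\<^sub>M borel)"
proof -
  interpret V: prob_space "gauss_vec n" by (rule prob_space_gauss_vec)
  define d where "d = (\<lambda>(s, w, z, hc, gc). ennreal ((1 / real n) * (\<Sum>i<n. (s i -
        g ((\<lambda>i\<in>{..<n}. hc * f s i + w i), (\<lambda>i\<in>{..<n}. gc * s i + z i), hc, gc) i)\<^sup>2)))"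
  have [measurable]: "d \<in> borel_measurable (vec_space n \<Otimes>\<^sub>M vec_space n \<Otimes>\<^sub>M vec_space n \<Otimes>\<^sub>M borel \<Otimes>\<^sub>M borel)"
    unfolding d_def by (rule decoder_error_measurable[OF assms])
  have cd: "cond_distortion n f g hc gc
    = (\<integral>\<^sup>+s. \<integral>\<^sup>+w. \<integral>\<^sup>+z. d (s, w, z, hc, gc) \<partial>gauss_vec n \<partial>gauss_vec n \<partial>gauss_vec n)" for hc gc
    by (simp add: cond_distortion_def d_def)
  show ?thesis unfolding cd by measurable
qed

lemma exp_distortion_eq:
  assumes f: "f \<in> vec_space n \<rightarrow>\<^sub>M vec_space n" and g: "admissible_decoder n g"
    and H: "prob_space muH" "sets muH = sets borel" and G: "prob_space muG" "sets muG = sets borel"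
  shows "exp_distortion n muH muG f g = (\<integral>\<^sup>+hc. \<integral>\<^sup>+gc. cond_distortion n f g hc gc \<partial>muG \<partial>muH)"
proof -
  let ?V = "gauss_vec n" and ?F = "muH \<Otimes>\<^sub>M muG"
  note H(2)[measurable_cong] G(2)[measurable_cong] cond_distortion_measurable[OF f g, measurable]
  interpret V: prob_space ?V by (rule prob_space_gauss_vec)
  interpret H: prob_space muH by fact
  interpret G: prob_space muG by fact
  interpret F: pair_prob_space muH muG ..
  define d where "d = (\<lambda>(s, w, z, hc, gc). ennreal ((1 / real n) * (\<Sum>i<n. (s i -
        g ((\<lambda>i\<in>{..<n}. hc * f s i + w i), (\<lambda>i\<in>{..<n}. gc * s i + z i), hc, gc) i)\<^sup>2)))"
  have [measurable]: "d \<in> borel_measurable (vec_space n \<Otimes>\<^sub>M vec_space n \<Otimes>\<^sub>M vec_space n \<Otimes>\<^sub>M borel \<Otimes>\<^sub>M borel)"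
    unfolding d_def by (rule decoder_error_measurable[OF f g])
  have "exp_distortion n muH muG f g = (\<integral>\<^sup>+\<omega>. d \<omega> \<partial>(?V \<Otimes>\<^sub>M ?V \<Otimes>\<^sub>M ?V \<Otimes>\<^sub>M ?F))"
    unfolding exp_distortion_def joint_law_def Let_def d_def ..
  also have "\<dots> = (\<integral>\<^sup>+h. \<integral>\<^sup>+s. \<integral>\<^sup>+w. \<integral>\<^sup>+z. d (s, w, z, h) \<partial>?V \<partial>?V \<partial>?V \<partial>?F)"
    by (rule nn_integral_pair4_rotate)
       (use V.sigma_finite_measure_axioms F.sigma_finite_measure_axioms in measurable)
  also have "\<dots> = (\<integral>\<^sup>+h. (case h of (hc, gc) \<Rightarrow> cond_distortion n f g hc gc) \<partial>?F)"
    by (intro nn_integral_cong) (auto simp: cond_distortion_def d_def)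
  also have "\<dots> = (\<integral>\<^sup>+hc. \<integral>\<^sup>+gc. cond_distortion n f g hc gc \<partial>muG \<partial>muH)"
    by (subst G.nn_integral_fst[symmetric]) auto
  finally show ?thesis .
qed

text \<open>Expand \<open>(c * e - z)^2 \<ge> 0\<close>. The resulting constant 2 is the slack that
  \<open>variance_product_bound\<close> tolerates.\<close>

lemma nn_integral_sum_square_add_le:
  fixes e z :: "'a \<Rightarrow> nat \<Rightarrow> real"
  assumes [measurable]: "\<And>i. i < n \<Longrightarrow> (\<lambda>\<omega>. e \<omega> i) \<in> borel_measurable M"
      "\<And>i. i < n \<Longrightarrow> (\<lambda>\<omega>. z \<omega> i) \<in> borel_measurable M"
    and E: "(\<integral>\<^sup>+\<omega>. ennreal (\<Sum>i<n. (e \<omega> i)\<^sup>2) \<partial>M) \<le> ennreal E" "0 \<le> E"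
    and Z: "(\<integral>\<^sup>+\<omega>. ennreal (\<Sum>i<n. (z \<omega> i)\<^sup>2) \<partial>M) \<le> ennreal Z" "0 \<le> Z"
  shows "(\<integral>\<^sup>+\<omega>. ennreal (\<Sum>i<n. (c * e \<omega> i + z \<omega> i)\<^sup>2) \<partial>M) \<le> ennreal (2 * c\<^sup>2 * E + 2 * Z)"
proof -
  have "(\<Sum>i<n. (c * e \<omega> i + z \<omega> i)\<^sup>2) \<le> 2 * c\<^sup>2 * (\<Sum>i<n. (e \<omega> i)\<^sup>2) + 2 * (\<Sum>i<n. (z \<omega> i)\<^sup>2)" for \<omega>
  proof -
    have "(c * e \<omega> i + z \<omega> i)\<^sup>2 \<le> 2 * c\<^sup>2 * (e \<omega> i)\<^sup>2 + 2 * (z \<omega> i)\<^sup>2" for i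
      using zero_le_power2[of "c * e \<omega> i - z \<omega> i"]
      by (simp add: power2_diff power2_sum power_mult_distrib)
    then show ?thesis
      by (simp add: sum_distrib_left sum.distrib[symmetric] sum_mono)
  qed
  then have "(\<integral>\<^sup>+\<omega>. ennreal (\<Sum>i<n. (c * e \<omega> i + z \<omega> i)\<^sup>2) \<partial>M)
    \<le> (\<integral>\<^sup>+\<omega>. ennreal (2 * c\<^sup>2) * ennreal (\<Sum>i<n. (e \<omega> i)\<^sup>2) + ennreal 2 * ennreal (\<Sum>i<n. (z \<omega> i)\<^sup>2) \<partial>M)"
    by (intro nn_integral_mono)
       (simp add: ennreal_mult[symmetric] ennreal_plus[symmetric] sum_nonneg ennreal_leI
          del: ennreal_plus ennreal_numeral)
  also have "\<dots> = (\<integral>\<^sup>+\<omega>. ennreal (2 * c\<^sup>2) * ennreal (\<Sum>i<n. (e \<omega> i)\<^sup>2) \<partial>M)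
      + (\<integral>\<^sup>+\<omega>. ennreal 2 * ennreal (\<Sum>i<n. (z \<omega> i)\<^sup>2) \<partial>M)"
    by (rule nn_integral_add) measurable
  also have "\<dots> = ennreal (2 * c\<^sup>2) * (\<integral>\<^sup>+\<omega>. ennreal (\<Sum>i<n. (e \<omega> i)\<^sup>2) \<partial>M)
      + ennreal 2 * (\<integral>\<^sup>+\<omega>. ennreal (\<Sum>i<n. (z \<omega> i)\<^sup>2) \<partial>M)"
    by (intro arg_cong2[where f="(+)"] nn_integral_cmult) measurable
  also have "\<dots> \<le> ennreal (2 * c\<^sup>2) * ennreal E + ennreal 2 * ennreal Z"
    by (intro add_mono mult_left_mono E Z) auto
  also have "\<dots> = ennreal (2 * c\<^sup>2 * E + 2 * Z)"
    using E Z by (simp add: ennreal_mult[symmetric] ennreal_plus[symmetric] del: ennreal_plus ennreal_numeral)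
  finally show ?thesis .
qed

text \<open>Index 0 is the estimator 0 of a standard Gaussian source, hence D 0 = 1.\<close>

lemma distortion_chain_bound:
  fixes D gs :: "nat \<Rightarrow> real"
  assumes n: "0 < n" and f: "admissible_encoder n f" and g: "admissible_decoder n g"
    and D: "D 0 = 1" "\<And>k. 0 < D k"
    and cd: "\<And>k. 0 < k \<Longrightarrow> k \<le> M \<Longrightarrow> cond_distortion n f g hc (gs k) \<le> ennreal (D k)"
  shows "1 \<le> exp (real M + 1) * (1 + hc\<^sup>2) * (\<Prod>k<M. 1 + (gs (Suc k))\<^sup>2 * D k) * D M"
proof -
  note f' = f[unfolded admissible_encoder_def, THEN conjunct1]
  have fi [measurable]: "(\<lambda>x. f x i) \<in> borel_measurable (vec_space n)" if "i < n" for i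
    using measurable_compose[OF f' vec_space_component[OF that]] by simp
  have gi [measurable]: "(\<lambda>x. g x i) \<in> borel_measurable (vec_space n \<Otimes>\<^sub>M vec_space n \<Otimes>\<^sub>M borel \<Otimes>\<^sub>M borel)"
    if "i < n" for i
    using measurable_compose[OF g[unfolded admissible_decoder_def] vec_space_component[OF that]] by simp
  \<comment> \<open>Observation 0 is the channel output and observation \<open>k > 0\<close> the
    side information of gain \<open>gs k\<close>, hence \<open>Suc M\<close> observations. The
    prediction of observation \<open>Suc j\<close> reads at most \<open>x 0\<close> and
    \<open>x j\<close>, both earlier; for \<open>j = 0\<close> it is 0, since \<open>dec 0\<close>
    is the zero estimator.\<close>
  define dec where "dec k y t = (if k = 0 then (\<lambda>_. 0) else g (y, t, hc, gs k))" for k y t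
  define m where "m k s i = (if k = 0 then hc * f s i else gs k * s i)" for k :: nat and s i
  define a where "a k x i = (case k of 0 \<Rightarrow> 0 | Suc j \<Rightarrow> gs (Suc j) * dec j (x 0) (x j) i)" for k x i
  define v where "v k = (case k of 0 \<Rightarrow> 1 + hc\<^sup>2 | Suc j \<Rightarrow> 1 + (gs (Suc j))\<^sup>2 * D j)" for k
  define b where "b x = dec M (x 0) (x M)" for x
  have dec_meas: "(\<lambda>x. dec k (x 0) (x k) i) \<in> borel_measurable (obs_space n J)" if "k < J" "i < n" for k i J
  proof -
    have [measurable]: "(\<lambda>x. x j) \<in> obs_space n J \<rightarrow>\<^sub>M vec_space n" if "j < J" for j
      using that by (intro measurable_component_singleton) auto
    have "0 < J" using that by simp
    then have "(\<lambda>x. g (x 0, x k, hc, gs k) i) \<in> borel_measurable (obs_space n J)"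
      using that by measurable
    then show ?thesis by (cases "k = 0") (simp_all add: dec_def)
  qed
  interpret gaussian_observations n "Suc M" m a v b "D M"
  proof
    show "0 < v k" for k
      by (cases k) (auto simp: v_def intro!: add_pos_nonneg mult_nonneg_nonneg less_imp_le[OF D(2)])
    show "0 < D M" by (rule D)
    show "(\<lambda>s. m k s i) \<in> borel_measurable (vec_space n)" if "i < n" for k i
      using that unfolding m_def by measurable
    show "a k (x(j := y)) = a k x" if "k \<le> j" for k j x y
      using that by (auto simp: a_def fun_eq_iff dec_def split: nat.split)
    show "(\<lambda>x. a k x i) \<in> borel_measurable (obs_space n J)" if "k < J" "i < n" for k i J
    proof (cases k)
      case (Suc j)
      then have [measurable]: "(\<lambda>x. dec j (x 0) (x j) i) \<in> borel_measurable (obs_space n J)"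
        using that by (intro dec_meas) auto
      show ?thesis by (simp add: a_def Suc)
    qed (simp add: a_def)
    show "(\<lambda>x. b x i) \<in> borel_measurable (obs_space n (Suc M))" if "i < n" for i
      unfolding b_def using that by (intro dec_meas) auto
  qed
  have om [measurable]: "(\<lambda>\<omega>. obs (fst \<omega>) (snd \<omega>)) \<in> vec_space n \<Otimes>\<^sub>M obs_space n (Suc M) \<rightarrow>\<^sub>M obs_space n (Suc M)"
    using obs_measurable by (simp add: case_prod_beta')
  have dm [measurable]: "(\<lambda>\<omega>. dec k (obs (fst \<omega>) (snd \<omega>) 0) (obs (fst \<omega>) (snd \<omega>) k) i) \<in> borel_measurable noise_law"
    if "k \<le> M" "i < n" for k i
    unfolding measurable_cong_sets[OF sets_noise_law refl]
    by (rule measurable_compose[OF om dec_meas]) (use that in auto)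
  have zm [measurable]: "(\<lambda>\<omega>. snd \<omega> k i) \<in> borel_measurable noise_law" if "k < Suc M" "i < n" for k i
    using that by measurable
  have dec_error: "(\<integral>\<^sup>+(s, z). ennreal (\<Sum>i<n. (s i - dec k (obs s z 0) (obs s z k) i)\<^sup>2) \<partial>noise_law)
      \<le> ennreal (real n * D k)" if "k \<le> M" for k
  proof (cases "k = 0")
    case True
    then show ?thesis using nn_integral_noise_source D by (simp add: dec_def)
  next
    case False
    interpret B: prob_space "gauss_blocks n (Suc M)" by (rule prob_space_gauss_blocks)
    interpret V: prob_space "gauss_vec n" by (rule prob_space_gauss_vec)
    have k: "k < Suc M" using that by simp
    define e where "e = (\<lambda>(s, w, z). ennreal ((1 / real n) * (\<Sum>i<n. (s i -
        g ((\<lambda>i\<in>{..<n}. hc * f s i + w i), (\<lambda>i\<in>{..<n}. gs k * s i + z i), hc, gs k) i)\<^sup>2)))"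
    have [measurable]: "e \<in> borel_measurable (vec_space n \<Otimes>\<^sub>M vec_space n \<Otimes>\<^sub>M vec_space n)"
    proof -
      have "(\<lambda>(s, w, z). (s, w, z, hc, gs k)) \<in> vec_space n \<Otimes>\<^sub>M vec_space n \<Otimes>\<^sub>M vec_space n
        \<rightarrow>\<^sub>M vec_space n \<Otimes>\<^sub>M vec_space n \<Otimes>\<^sub>M vec_space n \<Otimes>\<^sub>M borel \<Otimes>\<^sub>M borel"
        by measurable
      from measurable_compose[OF this decoder_error_measurable[OF f' g, of "1 / real n"]]
      show ?thesis by (simp add: e_def case_prod_beta')
    qed
    have [measurable]: "(\<lambda>x. x j) \<in> obs_space n (Suc M) \<rightarrow>\<^sub>M vec_space n" if "j < Suc M" for j
      using that by (intro measurable_component_singleton) auto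
    have [measurable]: "(\<lambda>\<omega>. e (fst \<omega>, snd \<omega> 0, snd \<omega> k)) \<in> borel_measurable (vec_space n \<Otimes>\<^sub>M obs_space n (Suc M))"
      using k by measurable
    \<comment> \<open>Only \<open>s\<close>, \<open>z 0\<close> and \<open>z k\<close> enter, and
      they are independent standard Gaussian vectors. The error of decoder \<open>k\<close> inside
      the joint experiment is therefore the conditional distortion at \<open>gs k\<close>,
      multiplied by \<open>n\<close>.\<close>
    have "(\<integral>\<^sup>+(s, z). ennreal (\<Sum>i<n. (s i - dec k (obs s z 0) (obs s z k) i)\<^sup>2) \<partial>noise_law)
      = (\<integral>\<^sup>+\<omega>. ennreal (real n) * e (fst \<omega>, snd \<omega> 0, snd \<omega> k) \<partial>noise_law)"
      using False that n
      by (intro nn_integral_cong)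
         (auto simp: e_def dec_def obs_def m_def sum_nonneg simp flip: ennreal_mult)
    also have "\<dots> = ennreal (real n) * (\<integral>\<^sup>+\<omega>. e (fst \<omega>, snd \<omega> 0, snd \<omega> k) \<partial>noise_law)"
      by (rule nn_integral_cmult) measurable
    also have "(\<integral>\<^sup>+\<omega>. e (fst \<omega>, snd \<omega> 0, snd \<omega> k) \<partial>noise_law)
      = (\<integral>\<^sup>+s. \<integral>\<^sup>+z. e (s, z 0, z k) \<partial>gauss_blocks n (Suc M) \<partial>gauss_vec n)"
      unfolding noise_law_def by (subst B.nn_integral_fst[symmetric]) auto
    also have "\<dots> = (\<integral>\<^sup>+s. \<integral>\<^sup>+w. \<integral>\<^sup>+z. e (s, w, z) \<partial>gauss_vec n \<partial>gauss_vec n \<partial>gauss_vec n)"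
    proof (intro nn_integral_cong)
      fix s assume "s \<in> space (gauss_vec n)"
      then have [measurable]: "s \<in> space (vec_space n)"
        by (simp add: sets_eq_imp_space_eq[OF sets_gauss_vec])
      show "(\<integral>\<^sup>+z. e (s, z 0, z k) \<partial>gauss_blocks n (Suc M)) = (\<integral>\<^sup>+w. \<integral>\<^sup>+z. e (s, w, z) \<partial>gauss_vec n \<partial>gauss_vec n)"
        using False that by (intro nn_integral_gauss_blocks_pair[of k "Suc M" "\<lambda>w z. e (s, w, z)"]) auto
    qed
    also have "\<dots> = cond_distortion n f g hc (gs k)"
      by (simp add: cond_distortion_def e_def)
    also have "ennreal (real n) * cond_distortion n f g hc (gs k) \<le> ennreal (real n) * ennreal (D k)"
      using False that by (intro mult_left_mono cd) auto
    also have "\<dots> = ennreal (real n * D k)"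
      using D(2)[of k] by (simp add: ennreal_mult)
    finally show ?thesis .
  qed
  have "1 \<le> exp (real (Suc M)) * (\<Prod>k<Suc M. v k) * D M"
  proof (rule variance_product_bound[OF n])
    show "(\<integral>\<^sup>+(s, z). ennreal (\<Sum>i<n. (s i - b (obs s z) i)\<^sup>2) \<partial>noise_law) \<le> ennreal (real n * D M)"
      unfolding b_def by (rule dec_error) simp
    fix k assume k: "k < Suc M"
    have z: "(\<integral>\<^sup>+\<omega>. ennreal (\<Sum>i<n. (snd \<omega> k i)\<^sup>2) \<partial>noise_law) \<le> ennreal (real n)"
      using nn_integral_noise_block[OF k] by (simp add: case_prod_beta')
    show "(\<integral>\<^sup>+(s, z). ennreal (\<Sum>i<n. (obs s z k i - a k (obs s z) i)\<^sup>2) \<partial>noise_law) \<le> ennreal (2 * real n * v k)"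
    proof (cases k)
      case 0
      interpret B: prob_space "gauss_blocks n (Suc M)" by (rule prob_space_gauss_blocks)
      \<comment> \<open>The power constraint enters here: it bounds the second moment of the channel
        output, whose prediction is 0.\<close>
      have "(\<integral>\<^sup>+\<omega>. ennreal (\<Sum>i<n. (f (fst \<omega>) i)\<^sup>2) \<partial>noise_law) = (\<integral>\<^sup>+s. ennreal (\<Sum>i<n. (f s i)\<^sup>2) \<partial>gauss_vec n)"
        unfolding noise_law_def by (subst B.nn_integral_fst[symmetric]) (auto simp: B.emeasure_space_1)
      then have "(\<integral>\<^sup>+\<omega>. ennreal (\<Sum>i<n. (f (fst \<omega>) i)\<^sup>2) \<partial>noise_law) \<le> ennreal (real n)"
        using f by (simp add: admissible_encoder_def)
      from nn_integral_sum_square_add_le[OF _ _ this _ z, of hc]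
      have "(\<integral>\<^sup>+\<omega>. ennreal (\<Sum>i<n. (hc * f (fst \<omega>) i + snd \<omega> k i)\<^sup>2) \<partial>noise_law)
        \<le> ennreal (2 * hc\<^sup>2 * real n + 2 * real n)"
        using k by simp
      moreover have "(\<integral>\<^sup>+(s, z). ennreal (\<Sum>i<n. (obs s z k i - a k (obs s z) i)\<^sup>2) \<partial>noise_law)
        = (\<integral>\<^sup>+\<omega>. ennreal (\<Sum>i<n. (hc * f (fst \<omega>) i + snd \<omega> k i)\<^sup>2) \<partial>noise_law)"
        using 0 by (intro nn_integral_cong) (auto simp: obs_apply a_def m_def)
      ultimately show ?thesis using 0 by (simp add: v_def algebra_simps)
    next
      case (Suc j)
      have de: "(\<integral>\<^sup>+\<omega>. ennreal (\<Sum>i<n. (fst \<omega> i - dec j (obs (fst \<omega>) (snd \<omega>) 0) (obs (fst \<omega>) (snd \<omega>) j) i)\<^sup>2) \<partial>noise_law)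
        \<le> ennreal (real n * D j)"
        using dec_error[of j] k Suc by (simp add: case_prod_beta')
      have em: "(\<lambda>\<omega>. fst \<omega> i - dec j (obs (fst \<omega>) (snd \<omega>) 0) (obs (fst \<omega>) (snd \<omega>) j) i) \<in> borel_measurable noise_law"
        if "i < n" for i
      proof (rule borel_measurable_diff)
        show "(\<lambda>\<omega>. fst \<omega> i) \<in> borel_measurable noise_law" using that by measurable
        show "(\<lambda>\<omega>. dec j (obs (fst \<omega>) (snd \<omega>) 0) (obs (fst \<omega>) (snd \<omega>) j) i) \<in> borel_measurable noise_law"
          using that k Suc by (intro dm) auto
      qed
      \<comment> \<open>The deviation of observation \<open>Suc j\<close> from its prediction is
        \<open>gs k\<close> times the error of decoder \<open>j\<close>, plus noise of block
        \<open>k\<close>. This is how \<open>D j\<close> gets into the next variance.\<close>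
      have "(\<integral>\<^sup>+\<omega>. ennreal (\<Sum>i<n. (gs k * (fst \<omega> i - dec j (obs (fst \<omega>) (snd \<omega>) 0) (obs (fst \<omega>) (snd \<omega>) j) i)
          + snd \<omega> k i)\<^sup>2) \<partial>noise_law) \<le> ennreal (2 * (gs k)\<^sup>2 * (real n * D j) + 2 * real n)"
        by (rule nn_integral_sum_square_add_le[OF em zm[OF k] de _ z])
           (simp_all add: less_imp_le[OF D(2)])
      moreover have "(\<integral>\<^sup>+(s, z). ennreal (\<Sum>i<n. (obs s z k i - a k (obs s z) i)\<^sup>2) \<partial>noise_law)
        = (\<integral>\<^sup>+\<omega>. ennreal (\<Sum>i<n. (gs k * (fst \<omega> i - dec j (obs (fst \<omega>) (snd \<omega>) 0) (obs (fst \<omega>) (snd \<omega>) j) i)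
          + snd \<omega> k i)\<^sup>2) \<partial>noise_law)"
        using Suc k by (intro nn_integral_cong) (auto simp: obs_apply a_def m_def algebra_simps)
      ultimately show ?thesis using Suc by (simp add: v_def algebra_simps)
    qed
  qed
  also have "(\<Prod>k<Suc M. v k) = (1 + hc\<^sup>2) * (\<Prod>k<M. 1 + (gs (Suc k))\<^sup>2 * D k)"
    by (subst prod.lessThan_Suc_shift) (simp add: v_def)
  finally show ?thesis by (simp add: algebra_simps)
qed

section \<open>Averaging over the fading\<close>

text \<open>Near 0 the density behaves like \<open>x powr (L - 1)\<close>, and the interval has
  length \<open>t\<close>. The bound \<open>t \<le> 1 / 2\<close> keeps \<open>x \<le> 1\<close>, so
  the exponential is at least \<open>exp (- 1 / \<theta>)\<close>; the minimum in
  \<open>\<kappa>\<close> covers increasing and decreasing powers alike.\<close>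

lemma gamma_measure_doubling_interval:
  assumes "0 < L" "0 < \<theta>"
  obtains \<kappa> where "0 < \<kappa>"
    "\<And>t. 0 < t \<Longrightarrow> t \<le> 1 / 2 \<Longrightarrow> ennreal (\<kappa> * t powr L) \<le> emeasure (gamma_measure L \<theta>) {t..2 * t}"
proof
  define Z where "Z = \<theta> powr L * Gamma L"
  define \<kappa> where "\<kappa> = min 1 (2 powr (L - 1)) * exp (- 1 / \<theta>) / Z"
  have Z: "0 < Z" using assms by (simp add: Z_def Gamma_real_pos)
  then show \<kappa>: "0 < \<kappa>" by (simp add: \<kappa>_def)
  fix t :: real assume t: "0 < t" "t \<le> 1 / 2"
  have *: "\<kappa> * t powr (L - 1) \<le> gamma_density L \<theta> x" if x: "t \<le> x" "x \<le> 2 * t" for x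
  proof -
    have "min 1 (2 powr (L - 1)) * t powr (L - 1) \<le> x powr (L - 1)"
    proof (cases "1 \<le> L")
      case True
      have "min 1 (2 powr (L - 1)) * t powr (L - 1) \<le> 1 * t powr (L - 1)"
        by (intro mult_right_mono) auto
      also have "\<dots> \<le> x powr (L - 1)" using True x t by (simp add: powr_mono2)
      finally show ?thesis .
    next
      case False
      have "min 1 (2 powr (L - 1)) * t powr (L - 1) \<le> 2 powr (L - 1) * t powr (L - 1)"
        by (intro mult_right_mono) auto
      also have "\<dots> = (2 * t) powr (L - 1)" using t by (simp add: powr_mult)
      also have "\<dots> \<le> x powr (L - 1)" using False x t by (intro powr_mono2') auto
      finally show ?thesis .
    qed
    moreover have "exp (- 1 / \<theta>) \<le> exp (- x / \<theta>)"
      using x t assms by (simp add: divide_right_mono)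
    ultimately have "min 1 (2 powr (L - 1)) * t powr (L - 1) * exp (- 1 / \<theta>) / Z \<le> x powr (L - 1) * exp (- x / \<theta>) / Z"
      using Z by (intro divide_right_mono mult_mono) auto
    then show ?thesis using x t by (simp add: gamma_density_def Z_def \<kappa>_def ac_simps)
  qed
  have [measurable]: "gamma_density L \<theta> \<in> borel_measurable borel"
    unfolding gamma_density_def by measurable
  have "ennreal (\<kappa> * t powr L) = ennreal (\<kappa> * t powr (L - 1)) * ennreal t"
    using t \<kappa> by (simp add: ennreal_mult[symmetric] powr_mult_base mult.assoc) (simp add: mult.commute powr_diff)
  also have "\<dots> = (\<integral>\<^sup>+x. ennreal (\<kappa> * t powr (L - 1)) * indicator {t..2 * t} x \<partial>lborel)"
    using t by (simp add: nn_integral_cmult_indicator)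
  also have "\<dots> \<le> (\<integral>\<^sup>+x. ennreal (gamma_density L \<theta> x) * indicator {t..2 * t} x \<partial>lborel)"
    using * by (intro nn_integral_mono) (auto split: split_indicator intro: ennreal_leI)
  also have "\<dots> = emeasure (gamma_measure L \<theta>) {t..2 * t}"
    unfolding gamma_measure_def by (simp add: emeasure_density)
  finally show "ennreal (\<kappa> * t powr L) \<le> emeasure (gamma_measure L \<theta>) {t..2 * t}" .
qed

text \<open>The condition is on the square because the model prescribes only the law of the squared
  fading coefficient and leaves its sign open.\<close>

definition square_band :: "real \<Rightarrow> real \<Rightarrow> real set" where
  "square_band \<rho> t = {x. \<rho> * t \<le> x\<^sup>2 \<and> x\<^sup>2 \<le> 2 * \<rho> * t}"

lemma square_band_borel [measurable]: "square_band \<rho> t \<in> sets borel"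
  unfolding square_band_def by measurable

lemma emeasure_scaled_square_band:
  assumes mu0: "sets mu0 = sets borel" "distr mu0 borel (\<lambda>x. x\<^sup>2) = N" and \<rho>: "0 < \<rho>"
  shows "emeasure (distr mu0 borel (\<lambda>x. sqrt \<rho> * x)) (square_band \<rho> t) = emeasure N {t..2 * t}"
proof -
  have "(\<lambda>x. sqrt \<rho> * x) -` square_band \<rho> t \<inter> space mu0 = (\<lambda>x. x\<^sup>2) -` {t..2 * t} \<inter> space mu0"
    using \<rho> sets_eq_imp_space_eq[OF mu0(1)] by (auto simp: square_band_def power_mult_distrib)
  then show ?thesis
    by (subst mu0(2)[symmetric]) (simp add: emeasure_distr measurable_cong_sets[OF mu0(1) refl])
qed

lemma prob_space_scaled:
  assumes "prob_space mu0" "sets mu0 = sets (borel :: real measure)"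
  shows "prob_space (distr mu0 borel (\<lambda>x. c * x))"
proof -
  show ?thesis
    by (rule prob_space.prob_space_distr[OF assms(1)]) (simp add: measurable_cong_sets[OF assms(2) refl])
qed

text \<open>Markov's inequality as a selection principle. If \<open>F\<close> exceeded
  \<open>2 * E / p\<close> on all of \<open>A\<close>, its integral would be at least
  \<open>2 * E\<close>; the factor 2 supplies the strict gap to \<open>E\<close>.\<close>

lemma exists_le_of_nn_integral_le:
  assumes "(\<integral>\<^sup>+x. F x \<partial>M) \<le> ennreal E" "ennreal p \<le> emeasure M A" "A \<in> sets M" "0 < E" "0 < p"
  shows "\<exists>x\<in>A. F x \<le> ennreal (2 * E / p)"
proof (rule ccontr)
  assume "\<not> ?thesis"
  then have *: "ennreal (2 * E / p) \<le> F x" if "x \<in> A" for x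
    using that by (auto simp: not_le less_imp_le)
  have "ennreal (2 * E) = ennreal (2 * E / p) * ennreal p"
    using assms by (simp add: ennreal_mult[symmetric])
  also have "\<dots> \<le> ennreal (2 * E / p) * emeasure M A"
    by (intro mult_left_mono assms) simp
  also have "\<dots> = (\<integral>\<^sup>+x. ennreal (2 * E / p) * indicator A x \<partial>M)"
    using assms by (simp add: nn_integral_cmult_indicator)
  also have "\<dots> \<le> (\<integral>\<^sup>+x. F x \<partial>M)"
    using * by (intro nn_integral_mono) (auto split: split_indicator)
  also have "\<dots> \<le> ennreal E" by fact
  finally show False using assms(4) by simp
qed

text \<open>This is the chain with a single side information: \<open>M = 1\<close> gives the
  constant \<open>exp 2\<close>, and the only gain factor is \<open>1 + gc^2\<close> because
  \<open>D 0 = 1\<close>.\<close>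

lemma cond_distortion_informed_bound:
  assumes "0 < n" "admissible_encoder n f" "admissible_decoder n g"
  shows "ennreal (exp (- 2) / ((1 + hc\<^sup>2) * (1 + gc\<^sup>2))) \<le> cond_distortion n f g hc gc"
proof (rule ccontr)
  define P where "P = (1 + hc\<^sup>2) * (1 + gc\<^sup>2)"
  define X where "X = exp (- 2) / P"
  have pos: "0 < P" unfolding P_def by (intro mult_pos_pos add_pos_nonneg) auto
  then have X: "0 < X" by (simp add: X_def)
  assume "\<not> ennreal (exp (- 2) / ((1 + hc\<^sup>2) * (1 + gc\<^sup>2))) \<le> cond_distortion n f g hc gc"
  then have lt: "cond_distortion n f g hc gc < ennreal X" by (simp add: X_def P_def)
  then obtain r where r: "cond_distortion n f g hc gc = ennreal r" "0 \<le> r"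
    by (cases "cond_distortion n f g hc gc") auto
  with lt X have rX: "r < X" by (simp add: ennreal_less_iff)
  \<comment> \<open>The chain bound wants a positive distortion level, but \<open>r\<close> may be
    0. The maximum with \<open>X / 2\<close> is positive and still below \<open>X\<close>.\<close>
  define \<delta> where "\<delta> = max r (X / 2)"
  have \<delta>: "0 < \<delta>" "\<delta> < X" "cond_distortion n f g hc gc \<le> ennreal \<delta>"
    using X rX r by (auto simp: \<delta>_def intro: ennreal_leI)
  have "1 \<le> exp (real 1 + 1) * (1 + hc\<^sup>2) * (\<Prod>k<1. 1 + ((\<lambda>_. gc) (Suc k))\<^sup>2 * (if k = 0 then 1 else \<delta>))
      * (if (1::nat) = 0 then 1 else \<delta>)"
    by (rule distortion_chain_bound[OF assms]) (use \<delta> in auto)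
  then have "1 \<le> exp 2 * P * \<delta>" by (simp add: P_def mult.assoc)
  also have "\<dots> < exp 2 * P * X"
    using \<delta> pos by (intro mult_strict_left_mono) auto
  also have "\<dots> = 1" using pos by (simp add: X_def exp_minus)
  finally show False by simp
qed

text \<open>A single band already contributes
  \<open>\<kappa> * t powr L / (1 + 2 * \<rho> * t)\<close>. For \<open>L \<le> 1\<close> the deep
  fade \<open>t = 1 / (2 * \<rho>)\<close> is taken, where the squared gain is of order 1; for
  \<open>L > 1\<close> the typical gain, \<open>t = 1 / 2\<close>. The two choices produce
  \<open>min L 1\<close>.\<close>

lemma nn_integral_inverse_one_plus_square:
  assumes L: "0 < L" and \<kappa>: "0 < \<kappa>"
  obtains c where "0 < c"
    "\<And>\<rho> mu. 1 \<le> \<rho> \<Longrightarrow> sets mu = sets borel \<Longrightarrow>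
      (\<And>t. 0 < t \<Longrightarrow> t \<le> 1 / 2 \<Longrightarrow> ennreal (\<kappa> * t powr L) \<le> emeasure mu (square_band \<rho> t)) \<Longrightarrow>
      ennreal (c * \<rho> powr (- min L 1)) \<le> (\<integral>\<^sup>+x. ennreal (1 / (1 + x\<^sup>2)) \<partial>mu)"
proof
  define c where "c = \<kappa> * (1 / 2) powr L / 2"
  show "0 < c" using \<kappa> by (simp add: c_def)
  fix \<rho> :: real and mu :: "real measure"
  assume \<rho>: "1 \<le> \<rho>" and [measurable_cong, simp]: "sets mu = sets borel"
    and band: "\<And>t. 0 < t \<Longrightarrow> t \<le> 1 / 2 \<Longrightarrow> ennreal (\<kappa> * t powr L) \<le> emeasure mu (square_band \<rho> t)"
  have *: "ennreal (\<kappa> * t powr L / (1 + 2 * \<rho> * t)) \<le> (\<integral>\<^sup>+x. ennreal (1 / (1 + x\<^sup>2)) \<partial>mu)"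
    if t: "0 < t" "t \<le> 1 / 2" for t
  proof -
    have p: "0 < 1 + 2 * \<rho> * t" using t \<rho> by (intro add_pos_nonneg) auto
    have "ennreal (\<kappa> * t powr L / (1 + 2 * \<rho> * t)) = ennreal (1 / (1 + 2 * \<rho> * t)) * ennreal (\<kappa> * t powr L)"
      using p \<kappa> by (simp add: ennreal_mult[symmetric])
    also have "\<dots> \<le> ennreal (1 / (1 + 2 * \<rho> * t)) * emeasure mu (square_band \<rho> t)"
      using t by (intro mult_left_mono band) auto
    also have "\<dots> = (\<integral>\<^sup>+x. ennreal (1 / (1 + 2 * \<rho> * t)) * indicator (square_band \<rho> t) x \<partial>mu)"
      by (simp add: nn_integral_cmult_indicator)
    also have "\<dots> \<le> (\<integral>\<^sup>+x. ennreal (1 / (1 + x\<^sup>2)) \<partial>mu)"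
      using p by (intro nn_integral_mono)
        (auto split: split_indicator simp: square_band_def intro!: ennreal_leI divide_left_mono mult_pos_pos add_pos_nonneg)
    finally show ?thesis .
  qed
  show "ennreal (c * \<rho> powr (- min L 1)) \<le> (\<integral>\<^sup>+x. ennreal (1 / (1 + x\<^sup>2)) \<partial>mu)"
  proof (cases "L \<le> 1")
    case True
    have "(1 / (2 * \<rho>)) powr L = (1 / 2) powr L * \<rho> powr - L"
      using \<rho> by (simp add: powr_mult powr_divide powr_minus divide_simps)
    then show ?thesis using True \<rho> *[of "1 / (2 * \<rho>)"] by (simp add: c_def min_def ac_simps)
  next
    case False
    have "c * \<rho> powr (- min L 1) = \<kappa> * (1 / 2) powr L / (2 * \<rho>)"
      using False \<rho> by (simp add: c_def min_def powr_minus divide_simps)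
    also have "\<dots> \<le> \<kappa> * (1 / 2) powr L / (1 + 2 * \<rho> * (1 / 2))"
      using \<rho> \<kappa> by (intro divide_left_mono) auto
    finally show ?thesis using *[of "1 / 2"] by (auto intro: order.trans ennreal_leI)
  qed
qed

text \<open>The levels, multiplied by 2 \<rho>, climb from \<rho> powr (1 - a) to \<rho> in steps of
  \<rho> powr (a / M).\<close>

definition level :: "real \<Rightarrow> nat \<Rightarrow> real \<Rightarrow> nat \<Rightarrow> real" where
  "level a M \<rho> j = \<rho> powr (- (a * (1 - real j / real M))) / 2"

lemma level_bounds:
  assumes "1 \<le> \<rho>" "0 \<le> a" "j \<le> M" "0 < M"
  shows "0 < level a M \<rho> j" "level a M \<rho> j \<le> 1 / 2" "\<rho> powr (- a) / 2 \<le> level a M \<rho> j"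
proof -
  have q: "0 \<le> 1 - real j / real M" "1 - real j / real M \<le> 1" using assms by auto
  have "0 \<le> a * (1 - real j / real M)" "a * (1 - real j / real M) \<le> a"
    using q assms by (auto intro: mult_left_le)
  moreover have "\<rho> powr (- (a * (1 - real j / real M))) \<le> \<rho> powr 0"
    using calculation assms by (intro powr_mono) auto
  moreover have "\<rho> powr (- a) \<le> \<rho> powr (- (a * (1 - real j / real M)))"
    using calculation assms by (intro powr_mono) auto
  ultimately show "0 < level a M \<rho> j" "level a M \<rho> j \<le> 1 / 2" "\<rho> powr (- a) / 2 \<le> level a M \<rho> j"
    using assms by (auto simp: level_def)
qed

lemma level_Suc:
  assumes "0 < \<rho>" "0 < M"
  shows "level a M \<rho> (Suc j) = level a M \<rho> j * \<rho> powr (a / real M)"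
proof -
  have "- (a * (1 - real (Suc j) / real M)) = - (a * (1 - real j / real M)) + a / real M"
    using assms by (simp add: field_simps)
  then show ?thesis unfolding level_def by (simp only: powr_add)
qed

text \<open>For \<open>L > 1\<close> the power is decreasing, so the lowest level
  \<open>\<rho> powr (- a) / 2\<close> is the worst, and \<open>a = 1 / L\<close> gives
  \<open>a * (L - 1) = 1 - a\<close>. For \<open>L \<le> 1\<close> the levels lie below 1 and the
  left side is at most 1.\<close>

lemma level_powr_le:
  assumes L: "0 < L" and a: "a = min 1 (1 / L)" and \<rho>: "1 \<le> \<rho>" and j: "j \<le> M" "0 < M"
  shows "level a M \<rho> j powr (1 - L) \<le> 2 powr L * \<rho> powr (1 - a)"
proof (cases "L \<le> 1")
  case True
  then have a1: "a = 1" using L by (simp add: a)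
  have "level a M \<rho> j powr (1 - L) \<le> 1"
    using level_bounds[of \<rho> a j M] \<rho> j True a1 by (intro powr_le1) auto
  also have "1 \<le> 2 powr L" using L by (simp add: ge_one_powr_ge_zero)
  finally show ?thesis using a1 \<rho> by simp
next
  case False
  then have aL: "a = 1 / L" "0 < a" by (auto simp: a min_def)
  have "level a M \<rho> j powr (1 - L) \<le> (\<rho> powr (- a) / 2) powr (1 - L)"
    using level_bounds[of \<rho> a j M] \<rho> j False aL by (intro powr_mono2') auto
  also have "\<dots> = \<rho> powr (- a * (1 - L)) * 2 powr (L - 1)"
    using \<rho> powr_minus[of 2 "1 - L"] by (simp add: powr_divide powr_powr inverse_eq_divide)
  also have "- a * (1 - L) = 1 - a" using False by (simp add: aL field_simps)
  also have "\<rho> powr (1 - a) * 2 powr (L - 1) \<le> \<rho> powr (1 - a) * 2 powr L"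
    by (intro mult_left_mono powr_mono) auto
  finally show ?thesis by (simp add: mult.commute)
qed

text \<open>The threshold \<open>\<rho>0\<close> is fixed before the block length and the code. This
  uniformity is what allows the infimum over codes and the limit inferior to be taken
  afterwards.\<close>

lemma exp_distortion_partially_informed_bound:
  fixes Lc Ls \<kappa>H \<kappa>G \<epsilon> a :: real
  assumes Ls: "0 < Ls" and \<kappa>: "0 < \<kappa>H" "0 < \<kappa>G" and \<epsilon>: "0 < \<epsilon>" and a: "a = min 1 (1 / Ls)"
  obtains \<rho>0 where "\<And>\<rho> muH muG n f g. \<rho>0 \<le> \<rho> \<Longrightarrow>
      prob_space muH \<Longrightarrow> sets muH = sets borel \<Longrightarrow> prob_space muG \<Longrightarrow> sets muG = sets borel \<Longrightarrow>
      (\<And>t. 0 < t \<Longrightarrow> t \<le> 1 / 2 \<Longrightarrow> ennreal (\<kappa>H * t powr Lc) \<le> emeasure muH (square_band \<rho> t)) \<Longrightarrow>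
      (\<And>t. 0 < t \<Longrightarrow> t \<le> 1 / 2 \<Longrightarrow> ennreal (\<kappa>G * t powr Ls) \<le> emeasure muG (square_band \<rho> t)) \<Longrightarrow>
      0 < n \<Longrightarrow> admissible_encoder n f \<Longrightarrow> admissible_decoder n g \<Longrightarrow>
      ennreal (\<rho> powr (- (2 - a + \<epsilon>))) \<le> exp_distortion n muH muG f g"
proof -
  \<comment> \<open>Since \<open>a \<le> 1\<close>, taking \<open>M > 1 / \<epsilon>\<close> makes
    the exponent \<open>a / M\<close> of one climbing step at most
    \<open>\<epsilon>\<close>.\<close>
  obtain M :: nat where M0: "1 / \<epsilon> < real M" using reals_Archimedean2 by blast
  have M: "0 < M" "a / real M \<le> \<epsilon>"
  proof -
    show "0 < M" using M0 \<epsilon> by (cases M) (auto simp: field_simps)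
    then have "1 / real M \<le> \<epsilon>" using M0 \<epsilon> by (simp add: field_simps)
    then show "a / real M \<le> \<epsilon>" using \<open>0 < M\<close> a
      by (intro order.trans[OF divide_right_mono[of a 1]]) auto
  qed
  have a01: "0 < a" "a \<le> 1" using Ls by (auto simp: a)
  \<comment> \<open>\<open>p\<close> bounds from below the probability that \<open>hc^2\<close> lies
    between \<open>\<rho> / 2\<close> and \<open>\<rho>\<close>. The 4 in \<open>C\<close> comes
    from two uses of Markov's inequality, and \<open>C1\<close> bounds the terms
    \<open>g_(k+1)^2 D_k\<close>. In \<open>C2\<close>, \<open>exp (real M + 2)\<close> belongs to a
    chain of \<open>M + 1\<close> side informations, 4 to the bounds \<open>2 * \<rho>\<close> and
    \<open>2 * \<rho> powr (1 - a)\<close> of the first two factors, and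
    \<open>C * 2 powr Ls\<close> to the distortion at the top level \<open>1 / 2\<close>.\<close>
  define p where "p = \<kappa>H * (1 / 2) powr Lc"
  define C where "C = 4 / (p * \<kappa>G)"
  define C1 where "C1 = 2 * C * 2 powr Ls"
  define C2 where "C2 = exp (real M + 2) * 4 * (1 + C1) ^ M * (C * 2 powr Ls)"
  have p: "0 < p" using \<kappa> by (simp add: p_def)
  have C: "0 < C" "0 < C1" "0 < C2"
  proof -
    show C: "0 < C" using p \<kappa> by (simp add: C_def)
    then show "0 < C1" by (simp add: C1_def)
    then have "0 < (1 + C1) ^ M" by simp
    with C show "0 < C2" by (simp add: C2_def)
  qed
  have "((\<lambda>\<rho>. C2 * \<rho> powr (- \<epsilon>)) \<longlongrightarrow> C2 * 0) at_top"
    using \<epsilon> by (intro tendsto_mult tendsto_const tendsto_neg_powr filterlim_ident) simp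
  then have "\<forall>\<^sub>F \<rho> in at_top. C2 * \<rho> powr (- \<epsilon>) < 1"
    by (intro order_tendstoD) auto
  then obtain \<rho>1 where \<rho>1: "\<And>\<rho>. \<rho>1 \<le> \<rho> \<Longrightarrow> C2 * \<rho> powr (- \<epsilon>) < 1"
    by (auto simp: eventually_at_top_linorder)
  show thesis
  proof (rule that[of "max 1 \<rho>1"], rule ccontr)
    fix \<rho> :: real and muH muG n f g
    assume "max 1 \<rho>1 \<le> \<rho>"
      and H: "prob_space muH" "sets muH = sets borel" and G: "prob_space muG" "sets muG = sets borel"
      and bH: "\<And>t. 0 < t \<Longrightarrow> t \<le> 1 / 2 \<Longrightarrow> ennreal (\<kappa>H * t powr Lc) \<le> emeasure muH (square_band \<rho> t)"
      and bG: "\<And>t. 0 < t \<Longrightarrow> t \<le> 1 / 2 \<Longrightarrow> ennreal (\<kappa>G * t powr Ls) \<le> emeasure muG (square_band \<rho> t)"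
      and n: "0 < n" and f: "admissible_encoder n f" and g: "admissible_decoder n g"
      and "\<not> ennreal (\<rho> powr (- (2 - a + \<epsilon>))) \<le> exp_distortion n muH muG f g"
    then have \<rho>: "1 \<le> \<rho>" "\<rho>1 \<le> \<rho>" by auto
    define E where "E = \<rho> powr (- (2 - a + \<epsilon>))"
    have E: "0 < E" using \<rho> by (simp add: E_def)
    have "exp_distortion n muH muG f g \<le> ennreal E"
      using \<open>\<not> _\<close> by (simp add: E_def)
    then have "(\<integral>\<^sup>+hc. \<integral>\<^sup>+gc. cond_distortion n f g hc gc \<partial>muG \<partial>muH) \<le> ennreal E"
      using f by (subst (asm) exp_distortion_eq[OF _ g H G]) (auto simp: admissible_encoder_def)
    \<comment> \<open>\<open>hc\<close> is chosen once, before any side-information gain, because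
      all members of the chain must share one channel output.\<close>
    from exists_le_of_nn_integral_le[OF this, of p "square_band \<rho> (1 / 2)"]
    obtain hc where hc: "hc \<in> square_band \<rho> (1 / 2)"
      "(\<integral>\<^sup>+gc. cond_distortion n f g hc gc \<partial>muG) \<le> ennreal (2 * E / p)"
      using bH[of "1 / 2"] H E p by (auto simp: p_def)
    let ?\<theta> = "level a M \<rho>"
    have \<theta>: "0 < ?\<theta> j" "?\<theta> j \<le> 1 / 2" if "j \<le> M" for j
      using level_bounds[of \<rho> a j M] \<rho> a01 M that by auto
    have "\<exists>gc. gc \<in> square_band \<rho> (?\<theta> j) \<and> cond_distortion n f g hc gc \<le> ennreal (C * E * ?\<theta> j powr (- Ls))"
      if "j \<le> M" for j
    proof -
      have "\<exists>gc\<in>square_band \<rho> (?\<theta> j). cond_distortion n f g hc gc \<le> ennreal (2 * (2 * E / p) / (\<kappa>G * ?\<theta> j powr Ls))"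
        using \<theta>[OF that] G E p \<kappa> by (intro exists_le_of_nn_integral_le[OF hc(2) bG]) auto
      moreover have "2 * (2 * E / p) / (\<kappa>G * ?\<theta> j powr Ls) = C * E * ?\<theta> j powr (- Ls)"
        by (simp add: C_def powr_minus divide_simps)
      ultimately show ?thesis by auto
    qed
    then obtain \<gamma> where \<gamma>: "\<And>j. j \<le> M \<Longrightarrow> \<gamma> j \<in> square_band \<rho> (?\<theta> j)"
      "\<And>j. j \<le> M \<Longrightarrow> cond_distortion n f g hc (\<gamma> j) \<le> ennreal (C * E * ?\<theta> j powr (- Ls))"
      by metis
    \<comment> \<open>Position 0 is reserved for the zero estimator, so level \<open>j\<close> sits
      at position \<open>Suc j\<close>. The levels from 0 to \<open>M\<close> give
      \<open>M + 1\<close> side informations, whence \<open>Suc M\<close> and the shift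
      \<open>k - 1\<close> in the application of the chain bound.\<close>
    define D where "D k = (case k of 0 \<Rightarrow> 1 | Suc j \<Rightarrow> C * E * ?\<theta> j powr (- Ls))" for k
    have D0: "0 < D k" for k
      using C E \<rho> by (cases k) (auto simp: D_def level_def)
    have "1 \<le> exp (real (Suc M) + 1) * (1 + hc\<^sup>2) * (\<Prod>k<Suc M. 1 + (\<gamma> (Suc k - 1))\<^sup>2 * D k) * D (Suc M)"
      by (rule distortion_chain_bound[OF n f g, where gs="\<lambda>k. \<gamma> (k - 1)"])
         (use \<gamma> D0 in \<open>auto simp: D_def split: nat.split\<close>)
    \<comment> \<open>The factor of the first gain is split off: it carries the prior variance 1
      instead of a decoder error, and may grow like \<open>\<rho> powr (1 - a)\<close>.\<close>
    also have "\<dots> = exp (real M + 2) * (1 + hc\<^sup>2) * ((1 + (\<gamma> 0)\<^sup>2) * (\<Prod>k<M. 1 + (\<gamma> (Suc k))\<^sup>2 * D (Suc k))) * D (Suc M)"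
      by (subst prod.lessThan_Suc_shift) (simp add: D_def add.commute)
    also have "\<dots> \<le> exp (real M + 2) * (2 * \<rho>) * ((2 * \<rho> powr (1 - a)) * (\<Prod>k<M. 1 + C1)) * (C * E * 2 powr Ls)"
    proof (intro mult_mono)
      show "1 + hc\<^sup>2 \<le> 2 * \<rho>" using hc(1) \<rho> by (simp add: square_band_def)
      have "(\<gamma> 0)\<^sup>2 \<le> 2 * \<rho> * ?\<theta> 0" using \<gamma>(1)[of 0] by (simp add: square_band_def)
      also have "\<dots> = \<rho> powr (1 - a)" using \<rho> by (simp add: level_def powr_diff powr_minus divide_simps)
      finally show "1 + (\<gamma> 0)\<^sup>2 \<le> 2 * \<rho> powr (1 - a)"
        using ge_one_powr_ge_zero[of \<rho> "1 - a"] \<rho> a01 by simp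
      show "D (Suc M) \<le> C * E * 2 powr Ls"
        using M \<rho> by (simp add: D_def level_def powr_minus powr_divide)
      show "(\<Prod>k<M. 1 + (\<gamma> (Suc k))\<^sup>2 * D (Suc k)) \<le> (\<Prod>k<M. 1 + C1)"
      proof (intro prod_mono conjI)
        fix k assume "k \<in> {..<M}"
        then have k: "k < M" by simp
        show "0 \<le> 1 + (\<gamma> (Suc k))\<^sup>2 * D (Suc k)" using D0[of "Suc k"] by simp
        \<comment> \<open>The gain belongs to level \<open>k + 1\<close> and the distortion to level
          \<open>k\<close>. This mismatch leaves one step
          \<open>\<rho> powr (a / real M)\<close>.\<close>
        have "(\<gamma> (Suc k))\<^sup>2 * D (Suc k) \<le> (2 * \<rho> * ?\<theta> (Suc k)) * (C * E * ?\<theta> k powr (- Ls))"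
          using \<gamma>(1)[of "Suc k"] k D0[of "Suc k"] by (intro mult_mono) (auto simp: square_band_def D_def)
        also have "\<dots> = 2 * C * E * \<rho> * \<rho> powr (a / real M) * ?\<theta> k powr (1 - Ls)"
        proof -
          have "?\<theta> k * ?\<theta> k powr (- Ls) = ?\<theta> k powr (1 - Ls)"
            using \<theta>(1)[of k] k by (simp add: powr_diff powr_minus divide_simps)
          then show ?thesis using \<rho> M by (simp add: level_Suc mult.commute mult.left_commute)
        qed
        also have "\<dots> \<le> 2 * C * E * \<rho> * \<rho> powr (a / real M) * (2 powr Ls * \<rho> powr (1 - a))"
          using k C E \<rho> Ls a M by (intro mult_left_mono level_powr_le) auto
        also have "\<dots> = C1 * (\<rho> powr (- (2 - a + \<epsilon>)) * \<rho> powr 1 * \<rho> powr (a / real M) * \<rho> powr (1 - a))"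
          using \<rho> by (simp add: C1_def E_def)
        \<comment> \<open>The exponents \<open>- (2 - a + \<epsilon>)\<close>, 1,
          \<open>a / M\<close> and \<open>1 - a\<close> add up to \<open>a / M - \<epsilon>\<close>,
          which the choice of \<open>M\<close> makes nonpositive.\<close>
        also have "\<dots> = C1 * \<rho> powr (a / real M - \<epsilon>)"
          unfolding powr_add[symmetric] by (simp add: algebra_simps)
        also have "\<dots> \<le> C1 * \<rho> powr 0"
          using M \<rho> C by (intro mult_left_mono powr_mono) auto
        finally show "1 + (\<gamma> (Suc k))\<^sup>2 * D (Suc k) \<le> 1 + C1" using \<rho> by simp
      qed
    qed (use C E \<rho> D0 in \<open>auto intro!: mult_nonneg_nonneg prod_nonneg add_nonneg_nonneg simp: less_imp_le\<close>)
    also have "\<dots> = C2 * (\<rho> powr 1 * \<rho> powr (1 - a) * E)"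
      using \<rho> by (simp add: C2_def)
    also have "\<dots> = C2 * \<rho> powr (- \<epsilon>)"
      unfolding E_def powr_add[symmetric] by (simp add: algebra_simps)
    also have "\<dots> < 1" by (rule \<rho>1) (rule \<rho>)
    finally show False by simp
  qed
qed

text \<open>The pointwise bound factors into a function of \<open>hc\<close> and one of
  \<open>gc\<close>, so independence of the two fading coefficients splits its average into two
  integrals of \<open>1 / (1 + x^2)\<close>, one for each exponent.\<close>

lemma exp_distortion_informed_bound:
  assumes L: "0 < Lc" "0 < Ls" and \<kappa>: "0 < \<kappa>H" "0 < \<kappa>G"
  obtains c where "0 < c" "\<And>\<rho> muH muG n f g. 1 \<le> \<rho> \<Longrightarrow>
      prob_space muH \<Longrightarrow> sets muH = sets borel \<Longrightarrow> prob_space muG \<Longrightarrow> sets muG = sets borel \<Longrightarrow>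
      (\<And>t. 0 < t \<Longrightarrow> t \<le> 1 / 2 \<Longrightarrow> ennreal (\<kappa>H * t powr Lc) \<le> emeasure muH (square_band \<rho> t)) \<Longrightarrow>
      (\<And>t. 0 < t \<Longrightarrow> t \<le> 1 / 2 \<Longrightarrow> ennreal (\<kappa>G * t powr Ls) \<le> emeasure muG (square_band \<rho> t)) \<Longrightarrow>
      0 < n \<Longrightarrow> admissible_encoder n f \<Longrightarrow> admissible_decoder n g \<Longrightarrow>
      ennreal (c * \<rho> powr (- (min Lc 1 + min Ls 1))) \<le> exp_distortion n muH muG f g"
proof -
  obtain cH where cH: "0 < cH" "\<And>\<rho> mu. 1 \<le> \<rho> \<Longrightarrow> sets mu = sets borel \<Longrightarrow>
      (\<And>t. 0 < t \<Longrightarrow> t \<le> 1 / 2 \<Longrightarrow> ennreal (\<kappa>H * t powr Lc) \<le> emeasure mu (square_band \<rho> t)) \<Longrightarrow>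
      ennreal (cH * \<rho> powr (- min Lc 1)) \<le> (\<integral>\<^sup>+x. ennreal (1 / (1 + x\<^sup>2)) \<partial>mu)"
    using nn_integral_inverse_one_plus_square[OF L(1) \<kappa>(1)] by blast
  obtain cG where cG: "0 < cG" "\<And>\<rho> mu. 1 \<le> \<rho> \<Longrightarrow> sets mu = sets borel \<Longrightarrow>
      (\<And>t. 0 < t \<Longrightarrow> t \<le> 1 / 2 \<Longrightarrow> ennreal (\<kappa>G * t powr Ls) \<le> emeasure mu (square_band \<rho> t)) \<Longrightarrow>
      ennreal (cG * \<rho> powr (- min Ls 1)) \<le> (\<integral>\<^sup>+x. ennreal (1 / (1 + x\<^sup>2)) \<partial>mu)"
    using nn_integral_inverse_one_plus_square[OF L(2) \<kappa>(2)] by blast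
  show thesis
  proof (rule that[of "exp (- 2) * (cH * cG)"])
    show "0 < exp (- 2) * (cH * cG)" using cH(1) cG(1) by simp
    fix \<rho> :: real and muH muG n f g
    assume \<rho>: "1 \<le> \<rho>"
      and H: "prob_space muH" "sets muH = sets borel" and G: "prob_space muG" "sets muG = sets borel"
      and bH: "\<And>t. 0 < t \<Longrightarrow> t \<le> 1 / 2 \<Longrightarrow> ennreal (\<kappa>H * t powr Lc) \<le> emeasure muH (square_band \<rho> t)"
      and bG: "\<And>t. 0 < t \<Longrightarrow> t \<le> 1 / 2 \<Longrightarrow> ennreal (\<kappa>G * t powr Ls) \<le> emeasure muG (square_band \<rho> t)"
      and adm: "0 < n" "admissible_encoder n f" "admissible_decoder n g"
    have m: "(\<lambda>x. ennreal (1 / (1 + x\<^sup>2))) \<in> borel_measurable muH"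
        "(\<lambda>x. ennreal (1 / (1 + x\<^sup>2))) \<in> borel_measurable muG"
      by (simp_all add: measurable_cong_sets[OF H(2) refl] measurable_cong_sets[OF G(2) refl])
    let ?I = "\<lambda>mu. \<integral>\<^sup>+x. ennreal (1 / (1 + x\<^sup>2)) \<partial>mu"
    have "ennreal (exp (- 2) * (cH * cG) * \<rho> powr (- (min Lc 1 + min Ls 1)))
      = ennreal (exp (- 2)) * (ennreal (cH * \<rho> powr (- min Lc 1)) * ennreal (cG * \<rho> powr (- min Ls 1)))"
    proof -
      have "\<rho> powr (- (min Lc 1 + min Ls 1)) = \<rho> powr (- min Lc 1) * \<rho> powr (- min Ls 1)"
        by (simp add: powr_add[symmetric])
      then show ?thesis using cH(1) cG(1) by (simp add: ennreal_mult[symmetric] ac_simps)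
    qed
    also have "\<dots> \<le> ennreal (exp (- 2)) * (?I muH * ?I muG)"
      by (intro mult_left_mono mult_mono cH(2)[OF \<rho> H(2) bH] cG(2)[OF \<rho> G(2) bG]) auto
    also have "\<dots> = (\<integral>\<^sup>+hc. ennreal (exp (- 2)) * (ennreal (1 / (1 + hc\<^sup>2)) * ?I muG) \<partial>muH)"
      using m by (simp add: nn_integral_cmult nn_integral_multc)
    also have "\<dots> = (\<integral>\<^sup>+hc. \<integral>\<^sup>+gc. ennreal (exp (- 2)) * (ennreal (1 / (1 + hc\<^sup>2)) * ennreal (1 / (1 + gc\<^sup>2))) \<partial>muG \<partial>muH)"
      using m by (simp add: nn_integral_cmult)
    also have "\<dots> \<le> (\<integral>\<^sup>+hc. \<integral>\<^sup>+gc. cond_distortion n f g hc gc \<partial>muG \<partial>muH)"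
    proof (intro nn_integral_mono)
      fix hc gc :: real
      have "ennreal (exp (- 2)) * (ennreal (1 / (1 + hc\<^sup>2)) * ennreal (1 / (1 + gc\<^sup>2)))
        = ennreal (exp (- 2) / ((1 + hc\<^sup>2) * (1 + gc\<^sup>2)))"
      proof -
        have "0 \<le> 1 / (1 + hc\<^sup>2)" "0 \<le> 1 / (1 + gc\<^sup>2)"
          by (auto intro!: divide_nonneg_nonneg add_nonneg_nonneg)
        then show ?thesis by (simp only: ennreal_mult[symmetric] mult_nonneg_nonneg exp_ge_zero) simp
      qed
      then show "ennreal (exp (- 2)) * (ennreal (1 / (1 + hc\<^sup>2)) * ennreal (1 / (1 + gc\<^sup>2)))
        \<le> cond_distortion n f g hc gc"
        using cond_distortion_informed_bound[OF adm] by simp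
    qed
    also have "\<dots> = exp_distortion n muH muG f g"
      using adm by (subst exp_distortion_eq[OF _ adm(3) H G]) (auto simp: admissible_encoder_def)
    finally show "ennreal (exp (- 2) * (cH * cG) * \<rho> powr (- (min Lc 1 + min Ls 1))) \<le> exp_distortion n muH muG f g" .
  qed
qed

section \<open>Passage to the optimal distortion and its exponent\<close>

text \<open>\<open>enn2real\<close> sends infinity to 0, so a lower bound survives the conversion
  only if the limit inferior is finite. The code that sends and outputs zeros has distortion 1 and
  settles this. Block length 0, where \<open>1 / real n\<close> is 0, is discarded by arguing
  eventually in \<open>n\<close>.\<close>

lemma opt_exp_distortion_ge:
  assumes H: "prob_space muH" "sets muH = sets borel" and G: "prob_space muG" "sets muG = sets borel"
    and x: "0 \<le> x" "\<And>n f g. 0 < n \<Longrightarrow> admissible_encoder n f \<Longrightarrow> admissible_decoder n g \<Longrightarrow>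
      ennreal x \<le> exp_distortion n muH muG f g"
  shows "x \<le> opt_exp_distortion muH muG"
proof -
  let ?I = "\<lambda>n. INF fg \<in> {(f, g). admissible_encoder n f \<and> admissible_decoder n g}.
    exp_distortion n muH muG (fst fg) (snd fg)"
  interpret H: prob_space muH by fact
  interpret G: prob_space muG by fact
  have I1: "?I n \<le> 1" if n: "0 < n" for n
  proof -
    let ?f = "\<lambda>_. \<lambda>i\<in>{..<n}. 0 :: real"
    interpret V: prob_space "gauss_vec n" by (rule prob_space_gauss_vec)
    have fm: "?f \<in> M \<rightarrow>\<^sub>M vec_space n" for M :: "'b measure"
      by (rule measurable_vec_spaceI) simp
    have f: "admissible_encoder n ?f" and g: "admissible_decoder n ?f"
      unfolding admissible_encoder_def admissible_decoder_def using fm by auto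
    have "cond_distortion n ?f ?f hc gc = 1" for hc gc
    proof -
      have "cond_distortion n ?f ?f hc gc = (\<integral>\<^sup>+s. ennreal (1 / real n) * ennreal (\<Sum>i<n. (s i)\<^sup>2) \<partial>gauss_vec n)"
        unfolding cond_distortion_def
        by (simp add: V.emeasure_space_1 ennreal_mult[symmetric] sum_nonneg)
      also have "\<dots> = ennreal (1 / real n) * ennreal (real n)"
        by (subst nn_integral_cmult) (auto simp: nn_integral_gauss_vec_square)
      also have "\<dots> = 1" using n by (simp add: ennreal_mult[symmetric])
      finally show ?thesis .
    qed
    then have "exp_distortion n muH muG ?f ?f = 1"
      by (simp add: exp_distortion_eq[OF fm g H G] H.emeasure_space_1 G.emeasure_space_1)
    moreover have "?I n \<le> exp_distortion n muH muG ?f ?f"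
      by (rule INF_lower2[of "(?f, ?f)"]) (use f g in auto)
    ultimately show ?thesis by simp
  qed
  have "liminf ?I \<le> 1"
  proof -
    have "liminf ?I \<le> liminf (\<lambda>_. 1 :: ennreal)"
      by (intro Liminf_mono eventually_sequentiallyI[of 1] I1) simp
    then show ?thesis by (simp add: Liminf_const)
  qed
  moreover have "ennreal x \<le> liminf ?I"
    by (intro Liminf_bounded eventually_sequentiallyI[of 1] INF_greatest) (auto intro: x)
  ultimately have "enn2real (ennreal x) \<le> enn2real (liminf ?I)"
    by (intro enn2real_mono) (auto intro: le_less_trans)
  then show ?thesis
    unfolding opt_exp_distortion_def using x(1) by simp
qed

text \<open>The lower bound by a positive power also makes \<open>ED \<rho>\<close> positive, so
  taking logarithms preserves the inequality. Afterwards the slack \<open>\<epsilon>\<close> tends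
  to 0.\<close>

lemma Limsup_exponent_le:
  fixes ED :: "real \<Rightarrow> real"
  assumes "\<And>\<epsilon>. 0 < \<epsilon> \<Longrightarrow> \<forall>\<^sub>F \<rho> in at_top. \<rho> powr (- (\<Delta> + \<epsilon>)) \<le> ED \<rho>"
  shows "Limsup at_top (\<lambda>\<rho>. ereal (- ln (ED \<rho>) / ln \<rho>)) \<le> ereal \<Delta>"
proof (rule ereal_le_epsilon2)
  fix \<epsilon> :: real assume \<epsilon>: "0 < \<epsilon>"
  have "\<forall>\<^sub>F \<rho> in at_top. - ln (ED \<rho>) / ln \<rho> \<le> \<Delta> + \<epsilon>"
    using assms[OF \<epsilon>] eventually_gt_at_top[of 1]
  proof eventually_elim
    case (elim \<rho>)
    have "0 < \<rho> powr (- (\<Delta> + \<epsilon>))" using elim by simp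
    then have "ln (\<rho> powr (- (\<Delta> + \<epsilon>))) \<le> ln (ED \<rho>)"
      using elim by (subst ln_le_cancel_iff) linarith+
    then have "- (\<Delta> + \<epsilon>) * ln \<rho> \<le> ln (ED \<rho>)" using elim by (simp add: ln_powr)
    then have "- ln (ED \<rho>) \<le> (\<Delta> + \<epsilon>) * ln \<rho>" by (simp add: algebra_simps)
    then show "- ln (ED \<rho>) / ln \<rho> \<le> \<Delta> + \<epsilon>" using elim by (simp only: pos_divide_le_eq ln_gt_zero)
  qed
  then show "Limsup at_top (\<lambda>\<rho>. ereal (- ln (ED \<rho>) / ln \<rho>)) \<le> ereal \<Delta> + ereal \<epsilon>"
    by (intro Limsup_bounded) simp
qed

text \<open>For \<open>Ls > 1\<close> the candidates are \<open>2 - 1 / Ls\<close> and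
  \<open>1 + min Lc 1\<close>. If \<open>Lc < 1\<close> they cross where
  \<open>1 - 1 / Ls = Lc\<close>, which is the threshold \<open>1 / (1 - Lc)\<close>; if
  \<open>Lc \<ge> 1\<close> the first stays below 2 and they never cross, which is the infinite
  threshold.\<close>

lemma min_Delta_eq_Delta_cases:
  assumes "0 < Lc" "0 < Ls"
  shows "min (Delta_pe Ls Lc) (Delta_inf Ls Lc) = Delta_cases Ls Lc"
proof (cases "Ls \<le> 1")
  case True
  then have "1 \<le> 1 / Ls" using assms by simp
  then show ?thesis using True assms
    by (auto simp: Delta_pe_def Delta_inf_def Delta_cases_def pos_part_def min_def max_def)
next
  case False
  then have L: "1 / Ls < 1" by simp
  show ?thesis
  proof (cases "1 \<le> Lc")
    case True
    with False L assms show ?thesis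
      by (auto simp: Delta_pe_def Delta_inf_def Delta_cases_def Ls_threshold_def pos_part_def min_def max_def)
  next
    case Lc: False
    have "Ls \<le> 1 / (1 - Lc) \<longleftrightarrow> 1 - 1 / Ls \<le> Lc"
      using Lc False by (simp add: field_simps)
    with Lc False L assms show ?thesis
      by (auto simp: Delta_pe_def Delta_inf_def Delta_cases_def Ls_threshold_def pos_part_def min_def max_def)
  qed
qed

theorem theorem3:
  fixes Lc Ls :: real and mu0H mu0G :: "real measure"
  assumes "Lc > 0" and "Ls > 0"
    and "prob_space mu0H" and "sets mu0H = sets borel"
    and "distr mu0H borel (\<lambda>x. x\<^sup>2) = gamma_measure Lc (1 / Lc)"
    and "prob_space mu0G" and "sets mu0G = sets borel"
    and "distr mu0G borel (\<lambda>x. x\<^sup>2) = gamma_measure Ls (1 / Ls)"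
  shows "(\<forall>\<^sub>F \<rho> in at_top. ED_nakagami mu0H mu0G \<rho> > 0)
       \<and> Limsup at_top (\<lambda>\<rho>. ereal (- ln (ED_nakagami mu0H mu0G \<rho>) / ln \<rho>))
           \<le> ereal (min (Delta_pe Ls Lc) (Delta_inf Ls Lc))
       \<and> min (Delta_pe Ls Lc) (Delta_inf Ls Lc) = Delta_cases Ls Lc"
proof -
  let ?ED = "ED_nakagami mu0H mu0G"
  define muH where "muH \<rho> = distr mu0H borel (\<lambda>x. sqrt \<rho> * x)" for \<rho>
  define muG where "muG \<rho> = distr mu0G borel (\<lambda>x. sqrt \<rho> * x)" for \<rho>
  have H: "prob_space (muH \<rho>)" "sets (muH \<rho>) = sets borel" for \<rho>
    unfolding muH_def using assms by (auto intro: prob_space_scaled)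
  have G: "prob_space (muG \<rho>)" "sets (muG \<rho>) = sets borel" for \<rho>
    unfolding muG_def using assms by (auto intro: prob_space_scaled)
  obtain \<kappa>H where \<kappa>H: "0 < \<kappa>H" "\<And>t. 0 < t \<Longrightarrow> t \<le> 1 / 2 \<Longrightarrow>
      ennreal (\<kappa>H * t powr Lc) \<le> emeasure (gamma_measure Lc (1 / Lc)) {t..2 * t}"
    using gamma_measure_doubling_interval[of Lc "1 / Lc"] assms by auto
  obtain \<kappa>G where \<kappa>G: "0 < \<kappa>G" "\<And>t. 0 < t \<Longrightarrow> t \<le> 1 / 2 \<Longrightarrow>
      ennreal (\<kappa>G * t powr Ls) \<le> emeasure (gamma_measure Ls (1 / Ls)) {t..2 * t}"
    using gamma_measure_doubling_interval[of Ls "1 / Ls"] assms by auto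
  have bH: "ennreal (\<kappa>H * t powr Lc) \<le> emeasure (muH \<rho>) (square_band \<rho> t)"
    if "1 \<le> \<rho>" "0 < t" "t \<le> 1 / 2" for \<rho> t
    using \<kappa>H(2)[OF that(2,3)] that(1) unfolding muH_def
    by (subst emeasure_scaled_square_band[OF assms(4,5)]) auto
  have bG: "ennreal (\<kappa>G * t powr Ls) \<le> emeasure (muG \<rho>) (square_band \<rho> t)"
    if "1 \<le> \<rho>" "0 < t" "t \<le> 1 / 2" for \<rho> t
    using \<kappa>G(2)[OF that(2,3)] that(1) unfolding muG_def
    by (subst emeasure_scaled_square_band[OF assms(7,8)]) auto
  have ED: "?ED \<rho> = opt_exp_distortion (muH \<rho>) (muG \<rho>)" for \<rho>
    by (simp add: ED_nakagami_def muH_def muG_def)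
  have pe: "\<forall>\<^sub>F \<rho> in at_top. \<rho> powr (- (Delta_pe Ls Lc + \<epsilon>)) \<le> ?ED \<rho>" if \<epsilon>: "0 < \<epsilon>" for \<epsilon>
  proof -
    have \<Delta>: "Delta_pe Ls Lc = 2 - min 1 (1 / Ls)"
      by (auto simp: Delta_pe_def pos_part_def min_def max_def)
    obtain \<rho>0 where \<rho>0: "\<And>\<rho> n f g. max 1 \<rho>0 \<le> \<rho> \<Longrightarrow> 0 < n \<Longrightarrow> admissible_encoder n f \<Longrightarrow> admissible_decoder n g \<Longrightarrow>
      ennreal (\<rho> powr (- (2 - min 1 (1 / Ls) + \<epsilon>))) \<le> exp_distortion n (muH \<rho>) (muG \<rho>) f g"
      using exp_distortion_partially_informed_bound[OF assms(2) \<kappa>H(1) \<kappa>G(1) \<epsilon> refl, of Lc]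
        H G bH bG by (metis max.bounded_iff)
    have "\<rho> powr (- (Delta_pe Ls Lc + \<epsilon>)) \<le> ?ED \<rho>" if "max 1 \<rho>0 \<le> \<rho>" for \<rho>
      unfolding ED \<Delta> using \<rho>0[OF that] by (intro opt_exp_distortion_ge H G) auto
    then show ?thesis unfolding eventually_at_top_linorder by blast
  qed
  have inf: "\<forall>\<^sub>F \<rho> in at_top. \<rho> powr (- (Delta_inf Ls Lc + \<epsilon>)) \<le> ?ED \<rho>" if \<epsilon>: "0 < \<epsilon>" for \<epsilon>
  proof -
    obtain c where c: "0 < c" "\<And>\<rho> n f g. 1 \<le> \<rho> \<Longrightarrow> 0 < n \<Longrightarrow> admissible_encoder n f \<Longrightarrow> admissible_decoder n g \<Longrightarrow>
      ennreal (c * \<rho> powr (- Delta_inf Ls Lc)) \<le> exp_distortion n (muH \<rho>) (muG \<rho>) f g"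
      using exp_distortion_informed_bound[OF assms(1,2) \<kappa>H(1) \<kappa>G(1)]
        H G bH bG unfolding Delta_inf_def by metis
    \<comment> \<open>The constant \<open>c\<close> is beaten by
      \<open>\<rho> powr (- \<epsilon>)\<close> for large \<open>\<rho>\<close>, at the price of
      \<open>\<epsilon>\<close> in the exponent.\<close>
    have "((\<lambda>\<rho>::real. \<rho> powr (- \<epsilon>)) \<longlongrightarrow> 0) at_top"
      using \<epsilon> by (intro tendsto_neg_powr filterlim_ident) simp
    then have "\<forall>\<^sub>F \<rho>::real in at_top. \<rho> powr (- \<epsilon>) < c"
      using c(1) by (intro order_tendstoD)
    with eventually_ge_at_top[of 1] show ?thesis
    proof eventually_elim
      case (elim \<rho>)
      have "\<rho> powr (- (Delta_inf Ls Lc + \<epsilon>)) = \<rho> powr (- \<epsilon>) * \<rho> powr (- Delta_inf Ls Lc)"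
        unfolding powr_add[symmetric] by (simp add: algebra_simps)
      also have "\<dots> \<le> c * \<rho> powr (- Delta_inf Ls Lc)"
        using elim by (intro mult_right_mono) auto
      also have "\<dots> \<le> ?ED \<rho>"
        unfolding ED using c elim by (intro opt_exp_distortion_ge H G) auto
      finally show ?case .
    qed
  qed
  \<comment> \<open>Positivity gives the logarithm its meaning: with the convention
    \<open>ln 0 = 0\<close>, a vanishing distortion would be counted as exponent 0.\<close>
  have "\<forall>\<^sub>F \<rho> in at_top. ?ED \<rho> > 0"
    using pe[OF zero_less_one] eventually_gt_at_top[of 0]
  proof eventually_elim
    case (elim \<rho>)
    have "0 < \<rho> powr (- (Delta_pe Ls Lc + 1))" using elim by simp
    then show ?case using elim by linarith
  qed
  moreover have "Limsup at_top (\<lambda>\<rho>. ereal (- ln (?ED \<rho>) / ln \<rho>)) \<le> ereal (min (Delta_pe Ls Lc) (Delta_inf Ls Lc))"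
    using Limsup_exponent_le[OF pe] Limsup_exponent_le[OF inf] by (auto simp: min_def)
  ultimately show ?thesis
    using min_Delta_eq_Delta_cases[OF assms(1,2)] by blast
qed

end
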